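(* Let $n\ge2$ and $r\ge1$ be integers. The extended polycyclic inverse semigroup $P_{n,r}$ is a compactable pre-Boolean inverse semigroup. Its Boolean completion $C_{n,r}=\mathsf{D}(P_{n,r})$ is a congruence-free Boolean inverse $\wedge$-monoid.
   Context: Polycyclic monoid. For $n\ge2$, $P_n$ is the monoid with zero presented by $\langle a_1,\ldots,a_n,a_1^{-1},\ldots,a_n^{-1} : a_i^{-1}a_i=1,\ a_i^{-1}a_j=0\ (i\neq j)\rangle$. Its non-zero elements are uniquely of the form $yx^{-1}$ with $x,y\in A^*$, the free monoid on $A=\{a_1,\ldots,a_n\}$; $yx^{-1}\cdot vu^{-1}$ equals $yzu^{-1}$ if $v=xz$, equals $y(uz)^{-1}$ if $x=vz$, and is $0$ otherwise. It is an inverse monoid. For an inverse monoid $M$ with zero, $B_r(M)$ consists of a zero and the triples $(i,m,j)$ with $1\le i,j\le r$ and $0\ne m\in M$; the product $(i,m,j)(k,p,l)$ is $(i,mp,l)$ if $j=k$ and $mp\neq0$, and is zero otherwise. $P_{n,r}=B_r(P_n)$. This is an inverse semigroup in which each pair of elements has a meet in the natural partial order ($s\le t$ iff $s=te$ for some idempotent $e$). An inverse $\wedge$-semigroup (or $\wedge$-monoid) is an inverse semigroup (monoid) with zero in which each pair of elements has a meet. Elements $s,t$ are compatible if $s^{-1}t$ and $st^{-1}$ are idempotents. An inverse semigroup is distributive if every finite non-empty compatible subset has a join and left and right multiplication by any element distributes over such joins; it is Boolean if it is distributive and its idempotents form a generalized Boolean algebra (distributive lattice with $0$ and relative complements, a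 top not being required). Congruence-free means that the only congruences are equality and the universal congruence. Distributive completion of an inverse $\wedge$-semigroup $S$. Write $\{a_1,\ldots,a_m\}\rightarrow\{b_1,\ldots,b_k\}$ if for each $i$ and each non-zero $x\le a_i$ there is $j$ with $x\wedge b_j\ne0$; $\leftrightarrow$ means both directions. On elements, $\leftrightarrow$ is a congruence on $S$; put $\mathbf{S}=S/\!\leftrightarrow$. Let $\mathsf{FC}(\mathbf{S})$ be the inverse semigroup, under multiplication of subsets, of all order ideals $\{a_1,\ldots,a_m\}^{\downarrow}$ of $\mathbf{S}$ generated by non-empty finite pairwise compatible subsets. Define $\{a_1,\ldots,a_m\}^\downarrow\equiv\{b_1,\ldots,b_k\}^\downarrow$ iff $\{a_1,\ldots,a_m\}\leftrightarrow\{b_1,\ldots,b_k\}$ in $\mathbf{S}$, a congruence. Then $\mathsf{D}(S)=\mathsf{FC}(\mathbf{S})/\!\equiv$, a distributive inverse $\wedge$-semigroup. $S$ is pre-Boolean if $\mathsf{D}(S)$ is Boolean, and then $\mathsf{D}(S)$ is called its Boolean completion. A pre-Boolean $S$ is compactable if there is a finite set $\{e_1,\ldots,e_k\}$ of non-zero idempotents (an essential set) such that every non-zero idempotent $e$ satisfies $e\wedge e_i\neq0$ for some $i$. *)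

theory Defs
  imports "HOL-Algebra.Lattice"
begin

section \<open>Semigroups with an explicit carrier\<close>

record 'a magma = "'a partial_object" +
  mul :: "'a \<Rightarrow> 'a \<Rightarrow> 'a" (infixl \<open>\<cdot>\<index>\<close> 70)

definition is_semigroup :: "('a, 'c) magma_scheme \<Rightarrow> bool" where
  "is_semigroup S \<longleftrightarrow>
     (\<forall>x\<in>carrier S. \<forall>y\<in>carrier S. x \<cdot>\<^bsub>S\<^esub> y \<in> carrier S) \<and>
     (\<forall>x\<in>carrier S. \<forall>y\<in>carrier S. \<forall>z\<in>carrier S.
        (x \<cdot>\<^bsub>S\<^esub> y) \<cdot>\<^bsub>S\<^esub> z = x \<cdot>\<^bsub>S\<^esub> (y \<cdot>\<^bsub>S\<^esub> z))"

definition is_monoid :: "('a, 'c) magma_scheme \<Rightarrow> bool" where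
  "is_monoid S \<longleftrightarrow> is_semigroup S \<and>
     (\<exists>e\<in>carrier S. \<forall>x\<in>carrier S. e \<cdot>\<^bsub>S\<^esub> x = x \<and> x \<cdot>\<^bsub>S\<^esub> e = x)"

definition is_zero :: "('a, 'c) magma_scheme \<Rightarrow> 'a \<Rightarrow> bool" where
  "is_zero S z \<longleftrightarrow> z \<in> carrier S \<and> (\<forall>x\<in>carrier S. z \<cdot>\<^bsub>S\<^esub> x = z \<and> x \<cdot>\<^bsub>S\<^esub> z = z)"

definition has_zero :: "('a, 'c) magma_scheme \<Rightarrow> bool" where
  "has_zero S \<longleftrightarrow> (\<exists>z. is_zero S z)"

definition zero_of :: "('a, 'c) magma_scheme \<Rightarrow> 'a" where
  "zero_of S = (THE z. is_zero S z)"

definition idems :: "('a, 'c) magma_scheme \<Rightarrow> 'a set" where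
  "idems S = {e \<in> carrier S. e \<cdot>\<^bsub>S\<^esub> e = e}"

definition is_sinv :: "('a, 'c) magma_scheme \<Rightarrow> 'a \<Rightarrow> 'a \<Rightarrow> bool" where
  "is_sinv S s t \<longleftrightarrow> t \<in> carrier S \<and> s \<cdot>\<^bsub>S\<^esub> t \<cdot>\<^bsub>S\<^esub> s = s \<and> t \<cdot>\<^bsub>S\<^esub> s \<cdot>\<^bsub>S\<^esub> t = t"

definition sinv :: "('a, 'c) magma_scheme \<Rightarrow> 'a \<Rightarrow> 'a" where
  "sinv S s = (THE t. is_sinv S s t)"

definition inverse_semigroup :: "('a, 'c) magma_scheme \<Rightarrow> bool" where
  "inverse_semigroup S \<longleftrightarrow> is_semigroup S \<and> (\<forall>s\<in>carrier S. \<exists>!t. is_sinv S s t)"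


section \<open>Congruences\<close>

definition semigroup_congruence :: "('a, 'c) magma_scheme \<Rightarrow> ('a \<times> 'a) set \<Rightarrow> bool" where
  "semigroup_congruence S R \<longleftrightarrow> equiv (carrier S) R \<and>
     (\<forall>(a, b)\<in>R. \<forall>c\<in>carrier S.
        (c \<cdot>\<^bsub>S\<^esub> a, c \<cdot>\<^bsub>S\<^esub> b) \<in> R \<and> (a \<cdot>\<^bsub>S\<^esub> c, b \<cdot>\<^bsub>S\<^esub> c) \<in> R)"

definition congruence_generated ::
    "('a, 'c) magma_scheme \<Rightarrow> ('a \<times> 'a) set \<Rightarrow> ('a \<times> 'a) set" where
  "congruence_generated S X = \<Inter> {R. semigroup_congruence S R \<and> X \<subseteq> R}"

definition congruence_free :: "('a, 'c) magma_scheme \<Rightarrow> bool" where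
  "congruence_free S \<longleftrightarrow>
     (\<forall>R. semigroup_congruence S R \<longrightarrow> R = Id_on (carrier S) \<or> R = carrier S \<times> carrier S)"

text \<open>If \<open>R\<close> is a congruence, the union below is the single class of the products
  of representatives.\<close>

definition quotient_magma :: "('a, 'c) magma_scheme \<Rightarrow> ('a \<times> 'a) set \<Rightarrow> 'a set magma" where
  "quotient_magma S R =
     \<lparr> carrier = carrier S // R,
       mul = (\<lambda>X Y. \<Union>x\<in>X. \<Union>y\<in>Y. R `` {x \<cdot>\<^bsub>S\<^esub> y}) \<rparr>"


section \<open>Natural partial order, meets and joins\<close>

definition nat_order :: "('a, 'c) magma_scheme \<Rightarrow> 'a gorder" where
  "nat_order S =
     \<lparr> carrier = carrier S, eq = (=), le = (\<lambda>s t. \<exists>e\<in>idems S. s = t \<cdot>\<^bsub>S\<^esub> e) \<rparr>"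

definition idem_order :: "('a, 'c) magma_scheme \<Rightarrow> 'a gorder" where
  "idem_order S = nat_order S \<lparr> carrier := idems S \<rparr>"

definition is_join :: "('a, 'c) magma_scheme \<Rightarrow> 'a set \<Rightarrow> 'a \<Rightarrow> bool" where
  "is_join S A j \<longleftrightarrow> least (nat_order S) j (Upper (nat_order S) A)"

definition inverse_meet_semigroup :: "('a, 'c) magma_scheme \<Rightarrow> bool" where
  "inverse_meet_semigroup S \<longleftrightarrow> inverse_semigroup S \<and> has_zero S \<and>
     (\<forall>s\<in>carrier S. \<forall>t\<in>carrier S.
        \<exists>m. greatest (nat_order S) m (Lower (nat_order S) {s, t}))"

definition inverse_meet_monoid :: "('a, 'c) magma_scheme \<Rightarrow> bool" where
  "inverse_meet_monoid S \<longleftrightarrow> inverse_meet_semigroup S \<and> is_monoid S"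

definition compat :: "('a, 'c) magma_scheme \<Rightarrow> 'a \<Rightarrow> 'a \<Rightarrow> bool" where
  "compat S s t \<longleftrightarrow> sinv S s \<cdot>\<^bsub>S\<^esub> t \<in> idems S \<and> s \<cdot>\<^bsub>S\<^esub> sinv S t \<in> idems S"

definition finite_compatible :: "('a, 'c) magma_scheme \<Rightarrow> 'a set \<Rightarrow> bool" where
  "finite_compatible S A \<longleftrightarrow>
     A \<subseteq> carrier S \<and> finite A \<and> A \<noteq> {} \<and> (\<forall>a\<in>A. \<forall>b\<in>A. compat S a b)"

definition distributive_inverse_semigroup :: "('a, 'c) magma_scheme \<Rightarrow> bool" where
  "distributive_inverse_semigroup S \<longleftrightarrow> inverse_semigroup S \<and>
     (\<forall>A. finite_compatible S A \<longrightarrow>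
        (\<exists>j. is_join S A j) \<and>
        (\<forall>j s. is_join S A j \<longrightarrow> s \<in> carrier S \<longrightarrow>
           is_join S ((\<lambda>a. s \<cdot>\<^bsub>S\<^esub> a) ` A) (s \<cdot>\<^bsub>S\<^esub> j) \<and>
           is_join S ((\<lambda>a. a \<cdot>\<^bsub>S\<^esub> s) ` A) (j \<cdot>\<^bsub>S\<^esub> s)))"

definition generalized_boolean_algebra :: "('a, 'c) gorder_scheme \<Rightarrow> bool" where
  "generalized_boolean_algebra L \<longleftrightarrow> lattice L \<and>
     (\<exists>z. least L z (carrier L)) \<and>
     (\<forall>x\<in>carrier L. \<forall>y\<in>carrier L. \<forall>z\<in>carrier L.
        x \<sqinter>\<^bsub>L\<^esub> (y \<squnion>\<^bsub>L\<^esub> z) = (x \<sqinter>\<^bsub>L\<^esub> y) \<squnion>\<^bsub>L\<^esub> (x \<sqinter>\<^bsub>L\<^esub> z)) \<and>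
     (\<forall>a\<in>carrier L. \<forall>b\<in>carrier L. \<forall>x\<in>carrier L. a \<sqsubseteq>\<^bsub>L\<^esub> x \<longrightarrow> x \<sqsubseteq>\<^bsub>L\<^esub> b \<longrightarrow>
        (\<exists>y\<in>carrier L. x \<sqinter>\<^bsub>L\<^esub> y = a \<and> x \<squnion>\<^bsub>L\<^esub> y = b))"

text \<open>The existence of a semigroup zero is demanded separately, since the least element of
  the lattice of idempotents need not be a zero (consider a group).\<close>

definition boolean_inverse_semigroup :: "('a, 'c) magma_scheme \<Rightarrow> bool" where
  "boolean_inverse_semigroup S \<longleftrightarrow> distributive_inverse_semigroup S \<and> has_zero S \<and>
     generalized_boolean_algebra (idem_order S)"


section \<open>Distributive completion\<close>

definition arrow :: "('a, 'c) magma_scheme \<Rightarrow> 'a set \<Rightarrow> 'a set \<Rightarrow> bool" where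
  "arrow S A B \<longleftrightarrow>
     (\<forall>a\<in>A. \<forall>x\<in>carrier S. x \<sqsubseteq>\<^bsub>nat_order S\<^esub> a \<longrightarrow> x \<noteq> zero_of S \<longrightarrow>
        (\<exists>b\<in>B. x \<sqinter>\<^bsub>nat_order S\<^esub> b \<noteq> zero_of S))"

definition biarrow :: "('a, 'c) magma_scheme \<Rightarrow> 'a set \<Rightarrow> 'a set \<Rightarrow> bool" where
  "biarrow S A B \<longleftrightarrow> arrow S A B \<and> arrow S B A"

definition biarrow_rel :: "('a, 'c) magma_scheme \<Rightarrow> ('a \<times> 'a) set" where
  "biarrow_rel S = {(a, b). a \<in> carrier S \<and> b \<in> carrier S \<and> biarrow S {a} {b}}"

definition separative_quotient :: "('a, 'c) magma_scheme \<Rightarrow> 'a set magma" where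
  "separative_quotient S = quotient_magma S (biarrow_rel S)"

definition order_ideal :: "('a, 'c) magma_scheme \<Rightarrow> 'a set \<Rightarrow> 'a set" where
  "order_ideal S A = {x \<in> carrier S. \<exists>a\<in>A. x \<sqsubseteq>\<^bsub>nat_order S\<^esub> a}"

definition FC :: "('a, 'c) magma_scheme \<Rightarrow> 'a set magma" where
  "FC S =
     \<lparr> carrier = {order_ideal S A | A. finite_compatible S A},
       mul = (\<lambda>X Y. {x \<cdot>\<^bsub>S\<^esub> y | x y. x \<in> X \<and> y \<in> Y}) \<rparr>"

definition FC_rel :: "('a, 'c) magma_scheme \<Rightarrow> ('a set \<times> 'a set) set" where
  "FC_rel S = {(order_ideal S A, order_ideal S B) | A B.
     finite_compatible S A \<and> finite_compatible S B \<and> biarrow S A B}"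

definition distributive_completion :: "('a, 'c) magma_scheme \<Rightarrow> 'a set set set magma" where
  "distributive_completion S =
     quotient_magma (FC (separative_quotient S)) (FC_rel (separative_quotient S))"

definition pre_boolean :: "('a, 'c) magma_scheme \<Rightarrow> bool" where
  "pre_boolean S \<longleftrightarrow>
     inverse_meet_semigroup S \<and> boolean_inverse_semigroup (distributive_completion S)"

definition essential_set :: "('a, 'c) magma_scheme \<Rightarrow> 'a set \<Rightarrow> bool" where
  "essential_set S F \<longleftrightarrow> finite F \<and> F \<subseteq> idems S - {zero_of S} \<and>
     (\<forall>e\<in>idems S - {zero_of S}. \<exists>f\<in>F. e \<sqinter>\<^bsub>nat_order S\<^esub> f \<noteq> zero_of S)"

definition compactable :: "('a, 'c) magma_scheme \<Rightarrow> bool" where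
  "compactable S \<longleftrightarrow> pre_boolean S \<and> (\<exists>F. essential_set S F)"


section \<open>Polycyclic monoids\<close>

datatype letter = Gen nat | Gen_inv nat

fun word0_mul :: "letter list option \<Rightarrow> letter list option \<Rightarrow> letter list option" where
  "word0_mul (Some u) (Some v) = Some (u @ v)"
| "word0_mul _ _ = None"

text \<open>The free monoid on \<open>a\<^sub>1, \<dots>, a\<^sub>n\<close> and their formal inverses with a zero adjoined;
  \<open>None\<close> is the zero and \<open>Some []\<close> the identity.\<close>

definition free_monoid0 :: "nat \<Rightarrow> letter list option magma" where
  "free_monoid0 n =
     \<lparr> carrier = insert None (Some ` lists (Gen ` {1..n} \<union> Gen_inv ` {1..n})),
       mul = word0_mul \<rparr>"

definition polycyclic_relations :: "nat \<Rightarrow> (letter list option \<times> letter list option) set" where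
  "polycyclic_relations n =
     {(Some [Gen_inv i, Gen i], Some []) | i. i \<in> {1..n}} \<union>
     {(Some [Gen_inv i, Gen j], None) | i j. i \<in> {1..n} \<and> j \<in> {1..n} \<and> i \<noteq> j}"

definition polycyclic :: "nat \<Rightarrow> letter list option set magma" where
  "polycyclic n = quotient_magma (free_monoid0 n)
     (congruence_generated (free_monoid0 n) (polycyclic_relations n))"

text \<open>\<open>B\<^sub>r(M)\<close>, with \<open>None\<close> as the zero.\<close>

definition brandt :: "nat \<Rightarrow> ('a, 'c) magma_scheme \<Rightarrow> (nat \<times> 'a \<times> nat) option magma" where
  "brandt r M =
     \<lparr> carrier = insert None
         (Some ` ({1..r} \<times> (carrier M - {zero_of M}) \<times> {1..r})),
       mul = (\<lambda>s t. case (s, t) of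
           (Some (i, m, j), Some (k, p, l)) \<Rightarrow>
             if j = k \<and> m \<cdot>\<^bsub>M\<^esub> p \<noteq> zero_of M then Some (i, m \<cdot>\<^bsub>M\<^esub> p, l) else None
         | _ \<Rightarrow> None) \<rparr>"

definition extended_polycyclic ::
    "nat \<Rightarrow> nat \<Rightarrow> (nat \<times> letter list option set \<times> nat) option magma" where
  "extended_polycyclic n r = brandt r (polycyclic n)"

end

theory Submission
  imports Defs "HOL-Library.Stream"
begin

text \<open>The idea is to represent every semigroup involved faithfully by partial bijections, so that
  the natural order becomes inclusion, meets become intersections, and compatibility means that the
  union is again a partial bijection. The element \<open>(i, yx\<inverse>, j)\<close> of \<open>P\<^sub>n\<^sub>,\<^sub>r\<close> acts on streams by
  exchanging the prefixes \<open>iy\<close> and \<open>jx\<close>. Only aperiodic streams are admitted: at an eventually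
  periodic point two incomparable elements can agree, and intersections would not be meets.
  A difference of two of these maps is a finite union of such maps; hence the arrow relation is
  inclusion of unions, the elements of the completion correspond to the finite unions that are
  partial bijections, and the latter are closed under differences, which gives the Boolean property.
  Given a congruence identifying two different elements, cutting down by idempotents shows that
  some non-zero element is congruent to zero; as \<open>n \<ge> 2\<close>, the identity factors through every
  non-zero element, so everything is congruent to zero.\<close>

section \<open>Semigroups of partial bijections\<close>

text \<open>The presentation is not known in advance to have unique normal forms. Rewriting shows
  only that every word reduces to zero or to some \<open>y x^-1\<close>; the action on streams then
  separates these, so the congruence generated by the relations is the kernel of the action. The
  separative relation and the relation on \<open>FC\<close> are kernels as well, and one lemma on
  kernel quotients serves all three constructions. Differences are finite unions because the
  alphabet is finite: removing the cylinder of \<open>uz\<close> from that of \<open>u\<close>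
  leaves the siblings met along \<open>z\<close>. Finiteness of \<open>r\<close> makes the identity
  on the whole stream space a finite join of the idempotents \<open>(i, 1, i)\<close>, which gives
  both the identity of the completion and the essential set. Two letters serve three purposes: the
  existence of an aperiodic stream, telling a cylinder from a proper subcylinder, and a prefix code
  of \<open>r\<close> words that folds all \<open>r\<close> copies of the space into a single
  cylinder.\<close>

definition partial_bij :: "('x \<times> 'x) set \<Rightarrow> bool" where
  "partial_bij R \<longleftrightarrow> single_valued R \<and> single_valued (R\<inverse>)"

lemma partial_bijD1: "partial_bij R \<Longrightarrow> (a, b) \<in> R \<Longrightarrow> (a, c) \<in> R \<Longrightarrow> b = c"
  and partial_bijD2: "partial_bij R \<Longrightarrow> (a, c) \<in> R \<Longrightarrow> (b, c) \<in> R \<Longrightarrow> a = b"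
  unfolding partial_bij_def single_valued_def by blast+

lemma partial_bijI:
  assumes "\<And>a b c. (a, b) \<in> R \<Longrightarrow> (a, c) \<in> R \<Longrightarrow> b = c"
    and "\<And>a b c. (a, c) \<in> R \<Longrightarrow> (b, c) \<in> R \<Longrightarrow> a = b"
  shows "partial_bij R"
  using assms unfolding partial_bij_def single_valued_def by blast

lemma partial_bij_subset: "partial_bij R \<Longrightarrow> Q \<subseteq> R \<Longrightarrow> partial_bij Q"
  unfolding partial_bij_def single_valued_def by blast

lemma partial_bij_converse [simp]: "partial_bij (R\<inverse>) \<longleftrightarrow> partial_bij R"
  by (auto simp: partial_bij_def)

lemma partial_bij_relcomp: "partial_bij R \<Longrightarrow> partial_bij Q \<Longrightarrow> partial_bij (R O Q)"
  unfolding partial_bij_def single_valued_def by blast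

lemma partial_bij_empty [simp]: "partial_bij {}"
  by (simp add: partial_bij_def)

lemma partial_bij_subset_Id: "R \<subseteq> Id \<Longrightarrow> partial_bij R"
  unfolding partial_bij_def single_valued_def by blast

text \<open>If \<open>(a, b)\<close> factors through \<open>c\<close>, single-valuedness of
  \<open>R\<close> gives \<open>c = b\<close> and injectivity gives \<open>c = a\<close>.\<close>

lemma relcomp_idem_iff:
  assumes "partial_bij R"
  shows "R O R = R \<longleftrightarrow> R \<subseteq> Id"
proof
  assume idem: "R O R = R"
  show "R \<subseteq> Id"
  proof
    fix p assume "p \<in> R"
    obtain a b where p: "p = (a, b)" "(a, b) \<in> R" using \<open>p \<in> R\<close> by (cases p) auto
    then obtain c where "(a, c) \<in> R" "(c, b) \<in> R" using idem by blast
    then have "c = b" "c = a" using p assms by (blast dest: partial_bijD1 partial_bijD2)+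
    then show "p \<in> Id" using p by simp
  qed
next
  assume "R \<subseteq> Id"
  then show "R O R = R" by blast
qed

text \<open>Each of the two equations puts the converse of one map inside the other map, so together
  they leave only one candidate. This is what makes semigroup inverses unique.\<close>

lemma relcomp_converse_iff:
  assumes R: "partial_bij R" and Q: "partial_bij Q"
  shows "R O Q O R = R \<and> Q O R O Q = Q \<longleftrightarrow> Q = R\<inverse>"
proof
  have 1: "A\<inverse> \<subseteq> B" if A: "partial_bij A" and AB: "A O B O A = A" for A B :: "('x \<times> 'x) set"
  proof
    fix p assume "p \<in> A\<inverse>"
    then obtain a b where p: "p = (b, a)" "(a, b) \<in> A" by auto
    then obtain c d where cd: "(a, c) \<in> A" "(c, d) \<in> B" "(d, b) \<in> A" using AB by blast
    then have "c = b" "d = a" using p A by (blast dest: partial_bijD1 partial_bijD2)+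
    then show "p \<in> B" using p cd by simp
  qed
  assume "R O Q O R = R \<and> Q O R O Q = Q"
  then have "R\<inverse> \<subseteq> Q" "Q\<inverse> \<subseteq> R" using 1 R Q by blast+
  then show "Q = R\<inverse>" by auto
next
  have 2: "A O A\<inverse> O A = A" if "partial_bij A" for A :: "('x \<times> 'x) set"
  proof -
    have "A\<inverse> O A \<subseteq> Id" using that by (auto dest: partial_bijD1)
    then have "A O A\<inverse> O A \<subseteq> A" by blast
    moreover have "A \<subseteq> A O A\<inverse> O A" by auto
    ultimately show ?thesis ..
  qed
  assume "Q = R\<inverse>"
  then show "R O Q O R = R \<and> Q O R O Q = Q" using 2[OF R] 2[OF Q] by simp
qed

text \<open>The two inclusions are single-valuedness and injectivity across the pieces. In a
  representation they say that \<open>s^-1 t\<close> and \<open>s t^-1\<close> are idempotent, so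
  compatibility is recognised on the union.\<close>

lemma partial_bij_Un_iff:
  assumes "partial_bij R" "partial_bij Q"
  shows "partial_bij (R \<union> Q) \<longleftrightarrow> R\<inverse> O Q \<subseteq> Id \<and> R O Q\<inverse> \<subseteq> Id"
proof
  assume "partial_bij (R \<union> Q)"
  then show "R\<inverse> O Q \<subseteq> Id \<and> R O Q\<inverse> \<subseteq> Id"
    unfolding partial_bij_def single_valued_def by blast
next
  assume "R\<inverse> O Q \<subseteq> Id \<and> R O Q\<inverse> \<subseteq> Id"
  then have 1: "(a, b) \<in> R \<Longrightarrow> (a, c) \<in> Q \<Longrightarrow> b = c" "(a, c) \<in> R \<Longrightarrow> (b, c) \<in> Q \<Longrightarrow> a = b" for a b c
    by blast+
  show "partial_bij (R \<union> Q)"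
    by (rule partial_bijI; use 1 assms in \<open>blast dest: partial_bijD1 partial_bijD2\<close>)
qed

text \<open>A failure of single-valuedness or injectivity involves two pairs only, hence at most two
  members of \<open>F\<close>. So pairwise compatibility of a set can be tested on its whole
  union.\<close>

lemma partial_bij_Union_iff:
  "partial_bij (\<Union>F) \<longleftrightarrow> (\<forall>R\<in>F. \<forall>Q\<in>F. partial_bij (R \<union> Q))"
proof
  assume "partial_bij (\<Union>F)"
  then show "\<forall>R\<in>F. \<forall>Q\<in>F. partial_bij (R \<union> Q)"
    by (auto elim!: partial_bij_subset)
next
  assume *: "\<forall>R\<in>F. \<forall>Q\<in>F. partial_bij (R \<union> Q)"
  show "partial_bij (\<Union>F)"
  proof (rule partial_bijI)
    fix a b c assume "(a, b) \<in> \<Union>F" "(a, c) \<in> \<Union>F"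
    then obtain R Q where "R \<in> F" "Q \<in> F" "(a, b) \<in> R \<union> Q" "(a, c) \<in> R \<union> Q" by blast
    then show "b = c" using * partial_bijD1 by meson
  next
    fix a b c assume "(a, c) \<in> \<Union>F" "(b, c) \<in> \<Union>F"
    then obtain R Q where "R \<in> F" "Q \<in> F" "(a, c) \<in> R \<union> Q" "(b, c) \<in> R \<union> Q" by blast
    then show "a = b" using * partial_bijD2 by meson
  qed
qed

section \<open>Meets and joins through an order embedding into sets\<close>

lemma greatest_Lower_iff:
  assumes "inj_on \<phi> (carrier L)"
    and "\<And>x y. x \<in> carrier L \<Longrightarrow> y \<in> carrier L \<Longrightarrow> x \<sqsubseteq>\<^bsub>L\<^esub> y \<longleftrightarrow> \<phi> x \<subseteq> \<phi> y"
    and "x \<in> carrier L" "y \<in> carrier L" "z \<in> carrier L" "\<phi> z = \<phi> x \<inter> \<phi> y"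
  shows "greatest L m (Lower L {x, y}) \<longleftrightarrow> m = z"
proof -
  have L: "Lower L {x, y} = {l \<in> carrier L. \<phi> l \<subseteq> \<phi> z}"
    using assms by (auto simp: Lower_def)
  show ?thesis
  proof
    assume "greatest L m (Lower L {x, y})"
    then have "m \<in> carrier L" "\<phi> m \<subseteq> \<phi> z" "\<phi> z \<subseteq> \<phi> m"
      unfolding greatest_def L using assms(2,5) by auto
    then show "m = z" using inj_onD[OF assms(1) _ _ assms(5)] by blast
  next
    assume "m = z"
    then show "greatest L m (Lower L {x, y})"
      unfolding greatest_def L using assms by auto
  qed
qed

text \<open>\<open>meet\<close> is defined by a choice operator; the preceding equivalence shows
  that only one value can be chosen. The order \<open>L\<close> is kept general because both
  \<open>nat_order\<close> and \<open>idem_order\<close> are treated.\<close>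

lemma meet_eqI:
  assumes "inj_on \<phi> (carrier L)"
    and "\<And>x y. x \<in> carrier L \<Longrightarrow> y \<in> carrier L \<Longrightarrow> x \<sqsubseteq>\<^bsub>L\<^esub> y \<longleftrightarrow> \<phi> x \<subseteq> \<phi> y"
    and "x \<in> carrier L" "y \<in> carrier L" "z \<in> carrier L" "\<phi> z = \<phi> x \<inter> \<phi> y"
  shows "x \<sqinter>\<^bsub>L\<^esub> y = z"
  unfolding meet_def inf_def using greatest_Lower_iff[OF assms] by simp

lemma least_Upper_iff:
  assumes "inj_on \<phi> (carrier L)"
    and "\<And>x y. x \<in> carrier L \<Longrightarrow> y \<in> carrier L \<Longrightarrow> x \<sqsubseteq>\<^bsub>L\<^esub> y \<longleftrightarrow> \<phi> x \<subseteq> \<phi> y"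
    and "X \<subseteq> carrier L" "z \<in> carrier L" "\<phi> z = \<Union>(\<phi> ` X)"
  shows "least L j (Upper L X) \<longleftrightarrow> j = z"
proof -
  have "Upper L X = {l \<in> carrier L. \<forall>x\<in>X. \<phi> x \<subseteq> \<phi> l}"
    unfolding Upper_def using assms(2,3) by (fastforce dest: subsetD)
  then have U: "Upper L X = {l \<in> carrier L. \<phi> z \<subseteq> \<phi> l}"
    using assms(5) by auto
  show ?thesis
  proof
    assume "least L j (Upper L X)"
    then have "j \<in> carrier L" "\<phi> j \<subseteq> \<phi> z" "\<phi> z \<subseteq> \<phi> j"
      unfolding least_def U using assms(2,4) by auto
    then show "j = z" using inj_onD[OF assms(1) _ _ assms(4)] by blast
  next
    assume "j = z"
    then show "least L j (Upper L X)"
      unfolding least_def U using assms by auto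
  qed
qed

lemma join_eqI:
  assumes "inj_on \<phi> (carrier L)"
    and "\<And>x y. x \<in> carrier L \<Longrightarrow> y \<in> carrier L \<Longrightarrow> x \<sqsubseteq>\<^bsub>L\<^esub> y \<longleftrightarrow> \<phi> x \<subseteq> \<phi> y"
    and "x \<in> carrier L" "y \<in> carrier L" "z \<in> carrier L" "\<phi> z = \<phi> x \<union> \<phi> y"
  shows "x \<squnion>\<^bsub>L\<^esub> y = z"
  unfolding join_def sup_def using least_Upper_iff[OF assms(1,2), of "{x, y}" z] assms by simp

section \<open>Faithful representations by partial bijections\<close>

definition partial_bij_family :: "('x \<times> 'x) set set \<Rightarrow> bool" where
  "partial_bij_family I \<longleftrightarrow> {} \<in> I \<and> (\<forall>R\<in>I. partial_bij R \<and> R\<inverse> \<in> I) \<and> (\<forall>R\<in>I. \<forall>Q\<in>I. R \<inter> Q \<in> I)"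

text \<open>The condition \<open>family\<close> makes the image an inverse meet-semigroup: the empty
  map is the zero, converses are inverses, intersections are meets. Closure under composition comes
  from \<open>mul_closed\<close> and \<open>hom\<close>.\<close>

locale partial_bij_rep =
  fixes S :: "('a, 'c) magma_scheme" (structure) and \<phi> :: "'a \<Rightarrow> ('x \<times> 'x) set"
  assumes mul_closed: "x \<in> carrier S \<Longrightarrow> y \<in> carrier S \<Longrightarrow> x \<cdot> y \<in> carrier S"
    and hom: "x \<in> carrier S \<Longrightarrow> y \<in> carrier S \<Longrightarrow> \<phi> (x \<cdot> y) = \<phi> x O \<phi> y"
    and inj: "inj_on \<phi> (carrier S)"
    and family: "partial_bij_family (\<phi> ` carrier S)"
begin

lemma eq_iff: "x \<in> carrier S \<Longrightarrow> y \<in> carrier S \<Longrightarrow> x = y \<longleftrightarrow> \<phi> x = \<phi> y"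
  using inj by (auto dest: inj_onD)

lemma pbij: "x \<in> carrier S \<Longrightarrow> partial_bij (\<phi> x)"
  using family by (auto simp: partial_bij_family_def)

lemma obtain_converse:
  assumes "x \<in> carrier S"
  obtains y where "y \<in> carrier S" "\<phi> y = (\<phi> x)\<inverse>"
proof -
  have "(\<phi> x)\<inverse> \<in> \<phi> ` carrier S" using assms family by (auto simp: partial_bij_family_def)
  then show thesis by (metis imageE that)
qed

lemma obtain_Int:
  assumes "x \<in> carrier S" "y \<in> carrier S"
  obtains z where "z \<in> carrier S" "\<phi> z = \<phi> x \<inter> \<phi> y"
proof -
  have "\<phi> x \<inter> \<phi> y \<in> \<phi> ` carrier S" using assms family by (auto simp: partial_bij_family_def)
  then show thesis by (metis imageE that)
qed

lemma obtain_empty: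
  obtains z where "z \<in> carrier S" "\<phi> z = {}"
proof -
  have "{} \<in> \<phi> ` carrier S" using family by (auto simp: partial_bij_family_def)
  then show thesis by (metis imageE that)
qed

lemma semigroup: "is_semigroup S"
  unfolding is_semigroup_def by (simp add: mul_closed eq_iff hom O_assoc)

lemma idems_iff: "e \<in> idems S \<longleftrightarrow> e \<in> carrier S \<and> \<phi> e \<subseteq> Id"
  unfolding idems_def using relcomp_idem_iff[OF pbij]
  by (auto simp: mul_closed eq_iff hom)

lemma is_sinv_iff:
  assumes "s \<in> carrier S"
  shows "is_sinv S s t \<longleftrightarrow> t \<in> carrier S \<and> \<phi> t = (\<phi> s)\<inverse>"
  unfolding is_sinv_def
  using relcomp_converse_iff[OF pbij pbij, of s t] assms
  by (auto simp: mul_closed eq_iff hom O_assoc)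

lemma ex1_sinv: "s \<in> carrier S \<Longrightarrow> \<exists>!t. is_sinv S s t"
  unfolding is_sinv_iff by (metis eq_iff obtain_converse)

lemma sinv:
  assumes "s \<in> carrier S"
  shows "sinv S s \<in> carrier S" "\<phi> (sinv S s) = (\<phi> s)\<inverse>"
  using theI'[OF ex1_sinv[OF assms]] is_sinv_iff[OF assms] by (simp_all add: sinv_def)

lemma inverse_semigroup: "inverse_semigroup S"
  by (simp add: inverse_semigroup_def semigroup ex1_sinv)

lemma le_iff:
  assumes s: "s \<in> carrier S" and t: "t \<in> carrier S"
  shows "s \<sqsubseteq>\<^bsub>nat_order S\<^esub> t \<longleftrightarrow> \<phi> s \<subseteq> \<phi> t"
proof
  assume "s \<sqsubseteq>\<^bsub>nat_order S\<^esub> t"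
  then obtain e where "e \<in> idems S" "s = t \<cdot> e" by (auto simp: nat_order_def)
  then show "\<phi> s \<subseteq> \<phi> t" using t by (auto simp: idems_iff hom)
next
  assume sub: "\<phi> s \<subseteq> \<phi> t"
  \<comment> \<open>The idempotent \<open>s^-1 s\<close> is the identity on the range of
    \<open>s\<close>; since \<open>t\<close> is injective, restricting \<open>t\<close> to that
    range leaves nothing but \<open>s\<close>.\<close>
  define e where "e = sinv S s \<cdot> s"
  have e: "e \<in> carrier S" "\<phi> e = (\<phi> s)\<inverse> O \<phi> s"
    using s sinv[OF s] by (auto simp: e_def mul_closed hom)
  have "\<phi> e \<subseteq> Id" using e partial_bijD1[OF pbij[OF s]] by auto
  moreover have "\<phi> t O \<phi> e = \<phi> s"
  proof
    show "\<phi> s \<subseteq> \<phi> t O \<phi> e" 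
    proof
      fix p assume "p \<in> \<phi> s"
      then have "(fst p, snd p) \<in> \<phi> t" "(snd p, snd p) \<in> \<phi> e"
        using sub e by (auto intro!: relcompI[of _ "fst p"])
      then show "p \<in> \<phi> t O \<phi> e" by (metis relcompI prod.collapse)
    qed
    show "\<phi> t O \<phi> e \<subseteq> \<phi> s"
    proof
      fix p assume "p \<in> \<phi> t O \<phi> e"
      then obtain a b c d where p: "p = (a, d)" "(a, b) \<in> \<phi> t" "(c, b) \<in> \<phi> s" "(c, d) \<in> \<phi> s"
        using e(2) by auto
      then have "a = c" using sub partial_bijD2[OF pbij[OF t]] by blast
      then show "p \<in> \<phi> s" using p by simp
    qed
  qed
  ultimately have "e \<in> idems S" "s = t \<cdot> e"
    using e(1) s t by (simp_all add: idems_iff eq_iff mul_closed hom)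
  then show "s \<sqsubseteq>\<^bsub>nat_order S\<^esub> t" by (auto simp: nat_order_def)
qed

lemma carrier_nat_order [simp]: "carrier (nat_order S) = carrier S"
  by (simp add: nat_order_def)

lemma greatest_iff:
  assumes "s \<in> carrier S" "t \<in> carrier S" "m \<in> carrier S" "\<phi> m = \<phi> s \<inter> \<phi> t"
  shows "greatest (nat_order S) k (Lower (nat_order S) {s, t}) \<longleftrightarrow> k = m"
  using assms inj by (intro greatest_Lower_iff[of \<phi>]) (auto simp: le_iff)

lemma meet:
  assumes "s \<in> carrier S" "t \<in> carrier S"
  shows "s \<sqinter>\<^bsub>nat_order S\<^esub> t \<in> carrier S" "\<phi> (s \<sqinter>\<^bsub>nat_order S\<^esub> t) = \<phi> s \<inter> \<phi> t"
proof -
  obtain m where m: "m \<in> carrier S" "\<phi> m = \<phi> s \<inter> \<phi> t" using obtain_Int assms by blast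
  have "s \<sqinter>\<^bsub>nat_order S\<^esub> t = m"
    using assms m inj by (intro meet_eqI[of \<phi>]) (auto simp: le_iff)
  with m show "s \<sqinter>\<^bsub>nat_order S\<^esub> t \<in> carrier S" "\<phi> (s \<sqinter>\<^bsub>nat_order S\<^esub> t) = \<phi> s \<inter> \<phi> t" by auto
qed

text \<open>An element with empty map exists, and a zero absorbs it, so the map of a zero is empty
  as well.\<close>

lemma is_zero_iff: "is_zero S z \<longleftrightarrow> z \<in> carrier S \<and> \<phi> z = {}"
proof -
  obtain o' where o: "o' \<in> carrier S" "\<phi> o' = {}" by (rule obtain_empty)
  show ?thesis
  proof
    assume z: "is_zero S z"
    then have "z = z \<cdot> o'" "z \<in> carrier S" using o by (auto simp: is_zero_def)
    then show "z \<in> carrier S \<and> \<phi> z = {}" using o hom[of z o'] by auto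
  next
    assume "z \<in> carrier S \<and> \<phi> z = {}"
    then show "is_zero S z" by (auto simp: is_zero_def eq_iff mul_closed hom)
  qed
qed

lemma zero: "zero_of S \<in> carrier S" "\<phi> (zero_of S) = {}"
proof -
  have "\<exists>!z. is_zero S z" unfolding is_zero_iff by (metis eq_iff obtain_empty)
  from theI'[OF this] show "zero_of S \<in> carrier S" "\<phi> (zero_of S) = {}"
    by (simp_all add: zero_of_def is_zero_iff)
qed

lemma eq_zero_iff: "x \<in> carrier S \<Longrightarrow> x = zero_of S \<longleftrightarrow> \<phi> x = {}"
  using zero by (simp add: eq_iff)

lemma has_zero: "has_zero S"
  unfolding has_zero_def is_zero_iff using zero by blast

lemma inverse_meet_semigroup: "inverse_meet_semigroup S"
  unfolding inverse_meet_semigroup_def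
  by (metis inverse_semigroup has_zero greatest_iff obtain_Int)

lemma compat_iff:
  assumes "s \<in> carrier S" "t \<in> carrier S"
  shows "compat S s t \<longleftrightarrow> partial_bij (\<phi> s \<union> \<phi> t)"
  unfolding compat_def partial_bij_Un_iff[OF pbij[OF assms(1)] pbij[OF assms(2)]]
  using assms by (simp add: idems_iff mul_closed hom sinv)

lemma finite_compatible_iff:
  "finite_compatible S X \<longleftrightarrow> X \<subseteq> carrier S \<and> finite X \<and> X \<noteq> {} \<and> partial_bij (\<Union>(\<phi> ` X))"
  unfolding finite_compatible_def partial_bij_Union_iff using compat_iff by (auto; blast)

end

section \<open>Boolean structure from unions and differences\<close>

locale boolean_partial_bij_rep = partial_bij_rep +
  assumes Un_closed: "x \<in> carrier S \<Longrightarrow> y \<in> carrier S \<Longrightarrow> partial_bij (\<phi> x \<union> \<phi> y) \<Longrightarrow>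
      \<phi> x \<union> \<phi> y \<in> \<phi> ` carrier S"
    and Diff_closed: "x \<in> carrier S \<Longrightarrow> y \<in> carrier S \<Longrightarrow> \<phi> x - \<phi> y \<in> \<phi> ` carrier S"
begin

lemma obtain_Union:
  assumes "finite X" "X \<subseteq> carrier S" "partial_bij (\<Union>(\<phi> ` X))"
  obtains z where "z \<in> carrier S" "\<phi> z = \<Union>(\<phi> ` X)"
proof -
  have "\<exists>z\<in>carrier S. \<phi> z = \<Union>(\<phi> ` X)"
    using assms
  proof (induction X rule: finite_induct)
    case empty
    then show ?case using zero by auto
  next
    case (insert x X)
    then have "partial_bij (\<Union>(\<phi> ` X))" by (auto elim: partial_bij_subset)
    then obtain z where z: "z \<in> carrier S" "\<phi> z = \<Union>(\<phi> ` X)"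
      using insert by auto
    then have "\<phi> x \<union> \<phi> z \<in> \<phi> ` carrier S" using insert.prems by (intro Un_closed) auto
    then show ?case using z by auto
  qed
  then show thesis using that by blast
qed

lemma is_join_iff:
  assumes "finite_compatible S X"
  shows "is_join S X j \<longleftrightarrow> j \<in> carrier S \<and> \<phi> j = \<Union>(\<phi> ` X)"
proof -
  have X: "X \<subseteq> carrier S" "finite X" "partial_bij (\<Union>(\<phi> ` X))"
    using assms by (auto simp: finite_compatible_iff)
  then obtain z where z: "z \<in> carrier S" "\<phi> z = \<Union>(\<phi> ` X)" using obtain_Union by blast
  have "is_join S X j \<longleftrightarrow> j = z"
    unfolding is_join_def using inj X z by (intro least_Upper_iff[of \<phi>]) (auto simp: le_iff)
  then show ?thesis using z eq_iff by auto
qed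

text \<open>Joins are unions, and relational composition distributes over unions on both
  sides.\<close>

lemma distributive: "distributive_inverse_semigroup S"
  unfolding distributive_inverse_semigroup_def
proof (intro conjI allI impI inverse_semigroup)
  fix X assume X: "finite_compatible S X"
  then have X': "X \<subseteq> carrier S" "finite X" "X \<noteq> {}" "partial_bij (\<Union>(\<phi> ` X))"
    by (auto simp: finite_compatible_iff)
  show "\<exists>j. is_join S X j"
    unfolding is_join_iff[OF X] using X' by (metis obtain_Union)
  fix j s assume "is_join S X j" and s: "s \<in> carrier S"
  then have j: "j \<in> carrier S" "\<phi> j = \<Union>(\<phi> ` X)" using is_join_iff[OF X] by auto
  have "\<phi> (s \<cdot> a) = \<phi> s O \<phi> a" "\<phi> (a \<cdot> s) = \<phi> a O \<phi> s" if "a \<in> X" for a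
    using X'(1) s that by (simp_all add: hom subset_iff)
  then have l: "\<Union>(\<phi> ` ((\<lambda>a. s \<cdot> a) ` X)) = \<phi> (s \<cdot> j)"
    and r: "\<Union>(\<phi> ` ((\<lambda>a. a \<cdot> s) ` X)) = \<phi> (j \<cdot> s)"
    using s j by (simp_all add: hom relcomp_UNION_distrib relcomp_UNION_distrib2)
  have sj: "s \<cdot> j \<in> carrier S" "j \<cdot> s \<in> carrier S" using s j by (simp_all add: mul_closed)
  have "(\<lambda>a. s \<cdot> a) ` X \<subseteq> carrier S" "(\<lambda>a. a \<cdot> s) ` X \<subseteq> carrier S"
    using X'(1) s by (auto intro!: mul_closed)
  \<comment> \<open>The union of the products is the map of \<open>s \<cdot> j\<close> or of
    \<open>j \<cdot> s\<close>, hence a partial bijection; this is why the products are again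
    compatible.\<close>
  then have fc: "finite_compatible S ((\<lambda>a. s \<cdot> a) ` X)" "finite_compatible S ((\<lambda>a. a \<cdot> s) ` X)"
    unfolding finite_compatible_iff l r using X'(2,3) sj by (simp_all add: pbij)
  show "is_join S ((\<lambda>a. s \<cdot> a) ` X) (s \<cdot> j)" "is_join S ((\<lambda>a. a \<cdot> s) ` X) (j \<cdot> s)"
    unfolding is_join_iff[OF fc(1)] is_join_iff[OF fc(2)] l r using sj by simp_all
qed

text \<open>Idempotents are subsets of the diagonal, so any two of them are compatible and
  \<open>Un_closed\<close> applies to all pairs: they form a ring of sets.\<close>

lemma boolean_algebra: "generalized_boolean_algebra (idem_order S)"
proof -
  let ?L = "idem_order S"
  have C: "x \<in> carrier ?L \<longleftrightarrow> x \<in> carrier S \<and> \<phi> x \<subseteq> Id" for x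
    by (simp add: idem_order_def idems_iff)
  have eq: "eq ?L = (=)" by (simp add: idem_order_def nat_order_def)
  have le: "x \<sqsubseteq>\<^bsub>?L\<^esub> y \<longleftrightarrow> \<phi> x \<subseteq> \<phi> y" if "x \<in> carrier ?L" "y \<in> carrier ?L" for x y
    using that le_iff[of x y] by (simp add: C) (simp add: idem_order_def)
  have inj': "inj_on \<phi> (carrier ?L)"
    using inj by (rule inj_on_subset) (auto simp: C)
  have obt: "\<exists>z\<in>carrier ?L. \<phi> z = R" if "R \<in> \<phi> ` carrier S" "R \<subseteq> Id" for R
    using that by (auto simp: C)
  have exN: "\<exists>z\<in>carrier ?L. \<phi> z = \<phi> x \<inter> \<phi> y" if "x \<in> carrier ?L" "y \<in> carrier ?L" for x y
    using that family by (intro obt) (auto simp: C partial_bij_family_def)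
  have exU: "\<exists>z\<in>carrier ?L. \<phi> z = \<phi> x \<union> \<phi> y" if "x \<in> carrier ?L" "y \<in> carrier ?L" for x y
    using that by (intro obt Un_closed partial_bij_subset_Id) (auto simp: C)
  have exD: "\<exists>z\<in>carrier ?L. \<phi> z = \<phi> x - \<phi> y" if "x \<in> carrier ?L" "y \<in> carrier ?L" for x y
    using that by (intro obt Diff_closed) (auto simp: C)
  have meet: "x \<sqinter>\<^bsub>?L\<^esub> y \<in> carrier ?L \<and> \<phi> (x \<sqinter>\<^bsub>?L\<^esub> y) = \<phi> x \<inter> \<phi> y"
    if xy: "x \<in> carrier ?L" "y \<in> carrier ?L" for x y
    using exN[OF that] meet_eqI[OF inj' le xy] by auto
  have join: "x \<squnion>\<^bsub>?L\<^esub> y \<in> carrier ?L \<and> \<phi> (x \<squnion>\<^bsub>?L\<^esub> y) = \<phi> x \<union> \<phi> y"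
    if xy: "x \<in> carrier ?L" "y \<in> carrier ?L" for x y
    using exU[OF that] join_eqI[OF inj' le xy] by auto
  have E: "x = y \<longleftrightarrow> \<phi> x = \<phi> y" if "x \<in> carrier ?L" "y \<in> carrier ?L" for x y
    using that eq_iff by (auto simp: C)
  have "partial_order ?L"
    by unfold_locales (use le E in \<open>auto simp: eq\<close>)
  then interpret PO: partial_order ?L .
  have lattice: "lattice ?L"
  proof unfold_locales
    fix x y assume xy: "x \<in> carrier ?L" "y \<in> carrier ?L"
    obtain z where "z \<in> carrier ?L" "\<phi> z = \<phi> x \<union> \<phi> y" using exU[OF xy] by blast
    then show "\<exists>s. least ?L s (Upper ?L {x, y})"
      using least_Upper_iff[OF inj' le, of "{x, y}" z] xy by auto
  next
    fix x y assume xy: "x \<in> carrier ?L" "y \<in> carrier ?L"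
    obtain z where "z \<in> carrier ?L" "\<phi> z = \<phi> x \<inter> \<phi> y" using exN[OF xy] by blast
    then show "\<exists>s. greatest ?L s (Lower ?L {x, y})"
      using greatest_Lower_iff[OF inj' le, of x y z] xy by auto
  qed
  have Z: "zero_of S \<in> carrier ?L" using zero by (simp add: C)
  then have bot: "\<exists>z. least ?L z (carrier ?L)"
    using zero by (intro exI[of _ "zero_of S"]) (auto simp: least_def le)
  have dist: "x \<sqinter>\<^bsub>?L\<^esub> (y \<squnion>\<^bsub>?L\<^esub> z) = (x \<sqinter>\<^bsub>?L\<^esub> y) \<squnion>\<^bsub>?L\<^esub> (x \<sqinter>\<^bsub>?L\<^esub> z)"
    if "x \<in> carrier ?L" "y \<in> carrier ?L" "z \<in> carrier ?L" for x y z
    using that by (simp add: E meet join Int_Un_distrib)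
  have compl: "\<exists>y\<in>carrier ?L. x \<sqinter>\<^bsub>?L\<^esub> y = a \<and> x \<squnion>\<^bsub>?L\<^esub> y = b"
    if abx: "a \<in> carrier ?L" "b \<in> carrier ?L" "x \<in> carrier ?L" "a \<sqsubseteq>\<^bsub>?L\<^esub> x" "x \<sqsubseteq>\<^bsub>?L\<^esub> b" for a b x
  proof -
    \<comment> \<open>The complement of \<open>x\<close> in the interval from \<open>a\<close> to
      \<open>b\<close> is the union of \<open>a\<close> and \<open>b - x\<close>.\<close>
    obtain d where d: "d \<in> carrier ?L" "\<phi> d = \<phi> b - \<phi> x" using exD[OF abx(2,3)] by blast
    obtain y where y: "y \<in> carrier ?L" "\<phi> y = \<phi> a \<union> \<phi> d" using exU[OF abx(1) d(1)] by blast
    then have "x \<sqinter>\<^bsub>?L\<^esub> y = a \<and> x \<squnion>\<^bsub>?L\<^esub> y = b"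
      using abx d by (auto simp: E meet join le)
    then show ?thesis using y by blast
  qed
  show ?thesis
    unfolding generalized_boolean_algebra_def
    by (intro conjI lattice bot ballI impI dist compl)
qed

lemma boolean_inverse_semigroup: "boolean_inverse_semigroup S"
  by (simp add: boolean_inverse_semigroup_def distributive has_zero boolean_algebra)

end

section \<open>A criterion for congruence-freeness\<close>

context boolean_partial_bij_rep
begin

text \<open>The idempotents that isolate a non-zero element come from two sources:
  \<open>separate\<close> cuts on the range side, and \<open>Diff_closed\<close> cuts on the domain
  side.\<close>

lemma congruence_free:
  assumes separate: "\<And>s p q q'. s \<in> carrier S \<Longrightarrow> (p, q) \<in> \<phi> s \<Longrightarrow> q' \<noteq> q \<Longrightarrow>
      \<exists>f\<in>idems S. (q, q) \<in> \<phi> f \<and> (q', q') \<notin> \<phi> f"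
    and unit: "\<And>x. x \<in> carrier S \<Longrightarrow> x \<cdot> u = x"
    and simple: "\<And>a. a \<in> carrier S \<Longrightarrow> \<phi> a \<noteq> {} \<Longrightarrow> \<exists>x\<in>carrier S. \<exists>y\<in>carrier S. x \<cdot> a \<cdot> y = u"
  shows "congruence_free S"
  unfolding congruence_free_def
proof (intro allI impI)
  fix R assume R: "semigroup_congruence S R"
  then have equiv: "equiv (carrier S) R" by (simp add: semigroup_congruence_def)
  then have R_sub: "R \<subseteq> carrier S \<times> carrier S" and R_refl: "x \<in> carrier S \<Longrightarrow> (x, x) \<in> R"
    and R_sym: "(x, y) \<in> R \<Longrightarrow> (y, x) \<in> R" and R_trans: "(x, y) \<in> R \<Longrightarrow> (y, z) \<in> R \<Longrightarrow> (x, z) \<in> R"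
    for x y z
    by (auto elim!: equivE dest: refl_onD symD transD)
  have left: "(c \<cdot> a, c \<cdot> b) \<in> R" and right: "(a \<cdot> c, b \<cdot> c) \<in> R"
    if "(a, b) \<in> R" "c \<in> carrier S" for a b c
    using R that unfolding semigroup_congruence_def by blast+
  show "R = Id_on (carrier S) \<or> R = carrier S \<times> carrier S"
  proof (cases "R = Id_on (carrier S)")
    case False
    then have "\<exists>s t. (s, t) \<in> R \<and> s \<noteq> t" using R_sub R_refl by (auto simp: Id_on_def)
    then obtain s t where "(s, t) \<in> R" "s \<noteq> t" by blast
    then have "\<phi> s \<noteq> \<phi> t" using R_sub eq_iff by blast
    then have "\<exists>s t. (s, t) \<in> R \<and> \<not> \<phi> s \<subseteq> \<phi> t" using \<open>(s, t) \<in> R\<close> R_sym by blast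
    then obtain s t p q where st: "(s, t) \<in> R" and pq: "(p, q) \<in> \<phi> s" "(p, q) \<notin> \<phi> t"
      by (auto simp: subset_iff)
    have s: "s \<in> carrier S" and t: "t \<in> carrier S" using st R_sub by auto
    \<comment> \<open>\<open>f\<close> keeps the value \<open>q\<close> of \<open>s\<close> at
      \<open>p\<close> and removes the value of \<open>t\<close> at \<open>p\<close>, if there is
      one. After multiplication by \<open>f\<close>, the point \<open>p\<close> is in the domain of
      \<open>s\<close> but not in that of \<open>t\<close>.\<close>
    have "\<exists>f\<in>idems S. (q, q) \<in> \<phi> f \<and> (\<forall>q'. (p, q') \<in> \<phi> t \<longrightarrow> (q', q') \<notin> \<phi> f)"
    proof (cases "\<exists>q'. (p, q') \<in> \<phi> t")
      case True
      then obtain q' where q': "(p, q') \<in> \<phi> t" by blast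
      then have "q' \<noteq> q" using pq by auto
      then obtain f where "f \<in> idems S" "(q, q) \<in> \<phi> f" "(q', q') \<notin> \<phi> f"
        using separate[OF s pq(1)] by blast
      then show ?thesis using q' partial_bijD1[OF pbij[OF t]] by blast
    next
      case False
      have ss: "sinv S s \<cdot> s \<in> carrier S" "\<phi> (sinv S s \<cdot> s) = (\<phi> s)\<inverse> O \<phi> s"
        using s sinv[OF s] by (simp_all add: mul_closed hom)
      then have "sinv S s \<cdot> s \<in> idems S" "(q, q) \<in> \<phi> (sinv S s \<cdot> s)"
        using pq(1) partial_bijD1[OF pbij[OF s]] by (auto simp: idems_iff)
      then show ?thesis using False by blast
    qed
    then obtain f where f: "f \<in> carrier S" "\<phi> f \<subseteq> Id" "(q, q) \<in> \<phi> f"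
      and pf: "\<And>q'. (p, q') \<in> \<phi> t \<Longrightarrow> (q', q') \<notin> \<phi> f"
      by (auto simp: idems_iff)
    have sf: "s \<cdot> f \<in> carrier S" "\<phi> (s \<cdot> f) = \<phi> s O \<phi> f"
      and tf: "t \<cdot> f \<in> carrier S" "\<phi> (t \<cdot> f) = \<phi> t O \<phi> f"
      using s t f by (simp_all add: mul_closed hom)
    have psf: "(p, q) \<in> \<phi> (s \<cdot> f)" using pq f sf by auto
    have ptf: "(p, b) \<notin> \<phi> (t \<cdot> f)" for b using pf f(2) tf by auto
    \<comment> \<open>\<open>d\<close> and \<open>g\<close> are the identities on the domains of
      \<open>s \<cdot> f\<close> and \<open>t \<cdot> f\<close>. Their difference \<open>e\<close>
      contains \<open>(p, p)\<close>, so it keeps \<open>s \<cdot> f\<close> non-zero, and it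
      annihilates \<open>t \<cdot> f\<close>.\<close>
    define d where "d = s \<cdot> f \<cdot> sinv S (s \<cdot> f)"
    define g where "g = t \<cdot> f \<cdot> sinv S (t \<cdot> f)"
    have d: "d \<in> carrier S" "\<phi> d = \<phi> (s \<cdot> f) O (\<phi> (s \<cdot> f))\<inverse>"
      and g: "g \<in> carrier S" "\<phi> g = \<phi> (t \<cdot> f) O (\<phi> (t \<cdot> f))\<inverse>"
      unfolding d_def g_def using sf tf sinv[OF sf(1)] sinv[OF tf(1)]
      by (simp_all add: mul_closed hom)
    have "\<phi> d - \<phi> g \<in> \<phi> ` carrier S" by (rule Diff_closed[OF d(1) g(1)])
    then obtain e where e: "e \<in> carrier S" "\<phi> e = \<phi> d - \<phi> g" by (metis imageE)
    have "\<phi> d \<subseteq> Id" using d(2) partial_bijD2[OF pbij[OF sf(1)]] by auto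
    then have eI: "\<phi> e \<subseteq> Id" using e by blast
    have "(p, p) \<in> \<phi> d" using d(2) psf by auto
    moreover have "(p, p) \<notin> \<phi> g" using g(2) ptf by auto
    ultimately have "(p, p) \<in> \<phi> e" using e(2) by blast
    then have "(p, q) \<in> \<phi> (e \<cdot> (s \<cdot> f))" using hom[OF e(1) sf(1)] psf by auto
    then have nz: "\<phi> (e \<cdot> (s \<cdot> f)) \<noteq> {}" by blast
    have "\<phi> e O \<phi> (t \<cdot> f) = {}"
    proof -
      have "False" if "(a, b) \<in> \<phi> e" "(b, c) \<in> \<phi> (t \<cdot> f)" for a b c
      proof -
        have "a = b" using that eI by blast
        then have "(a, b) \<in> \<phi> g" using that g(2) by auto
        then show False using that e(2) by blast
      qed
      then show ?thesis by blast
    qed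
    then have "e \<cdot> (t \<cdot> f) = zero_of S"
      using hom[OF e(1) tf(1)] e tf by (simp add: eq_zero_iff mul_closed)
    then have Rz: "(e \<cdot> (s \<cdot> f), zero_of S) \<in> R"
      using left[OF right[OF st f(1)] e(1)] by simp
    have "e \<cdot> (s \<cdot> f) \<in> carrier S" using e sf by (simp add: mul_closed)
    from simple[OF this nz] obtain x y where
      x: "x \<in> carrier S" and y: "y \<in> carrier S" and xy: "x \<cdot> (e \<cdot> (s \<cdot> f)) \<cdot> y = u" by blast
    have zero_mul: "zero_of S \<cdot> c = zero_of S" "c \<cdot> zero_of S = zero_of S" if "c \<in> carrier S" for c
      using that zero by (simp_all add: eq_zero_iff mul_closed hom)
    have Ru: "(u, zero_of S) \<in> R"
      using right[OF left[OF Rz x] y] x y xy by (simp add: zero_mul)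
    have "(c, zero_of S) \<in> R" if "c \<in> carrier S" for c
      using left[OF Ru that] that by (simp add: unit zero_mul)
    then have "R = carrier S \<times> carrier S" using R_sub R_sym R_trans by blast
    then show ?thesis ..
  qed simp
qed

end

section \<open>Quotients by kernels\<close>

definition kernel_rel :: "('a, 'c) magma_scheme \<Rightarrow> ('a \<Rightarrow> 'b) \<Rightarrow> ('a \<times> 'a) set" where
  "kernel_rel M f = {(x, y). x \<in> carrier M \<and> y \<in> carrier M \<and> f x = f y}"

text \<open>\<open>f\<close> is constant on the classes of its kernel, so the union over a class is
  the common value and the induced map is injective. This serves the presentation, the separative
  quotient and the quotient of \<open>FC\<close>.\<close>

lemma
  fixes M :: "('a, 'c) magma_scheme" (structure) and f :: "'a \<Rightarrow> ('x \<times> 'x) set"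
  assumes closed: "\<And>x y. x \<in> carrier M \<Longrightarrow> y \<in> carrier M \<Longrightarrow> x \<cdot> y \<in> carrier M"
    and hom: "\<And>x y. x \<in> carrier M \<Longrightarrow> y \<in> carrier M \<Longrightarrow> f (x \<cdot> y) = f x O f y"
    and family: "partial_bij_family (f ` carrier M)"
  defines "Q \<equiv> quotient_magma M (kernel_rel M f)"
  shows kernel_quotient_rep: "partial_bij_rep Q (\<lambda>X. \<Union>(f ` X))"
    and kernel_quotient_image: "(\<lambda>X. \<Union>(f ` X)) ` carrier Q = f ` carrier M"
proof -
  let ?K = "kernel_rel M f" and ?F = "\<lambda>X. \<Union>(f ` X)"
  have cls: "?K `` {x} = {y \<in> carrier M. f y = f x}" if "x \<in> carrier M" for x
    using that by (auto simp: kernel_rel_def)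
  have F: "?F (?K `` {x}) = f x" if "x \<in> carrier M" for x
    using that by (auto simp: cls)
  have Q: "X \<in> carrier Q \<longleftrightarrow> (\<exists>x\<in>carrier M. X = ?K `` {x})" for X
    by (auto simp: Q_def quotient_magma_def quotient_def)
  have mult: "?K `` {x} \<cdot>\<^bsub>Q\<^esub> ?K `` {y} = ?K `` {x \<cdot> y}" if "x \<in> carrier M" "y \<in> carrier M" for x y
  proof -
    have "?K `` {x' \<cdot> y'} = ?K `` {x \<cdot> y}" if "x' \<in> ?K `` {x}" "y' \<in> ?K `` {y}" for x' y'
      using that \<open>x \<in> carrier M\<close> \<open>y \<in> carrier M\<close> by (simp add: cls closed hom)
    then have "?K `` {x} \<cdot>\<^bsub>Q\<^esub> ?K `` {y} = (\<Union>x'\<in>?K `` {x}. \<Union>y'\<in>?K `` {y}. ?K `` {x \<cdot> y})"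
      unfolding Q_def quotient_magma_def by simp
    \<comment> \<open>A union over representatives of one constant class equals that class only when
      both index sets are inhabited.\<close>
    moreover have "?K `` {x} \<noteq> {}" "?K `` {y} \<noteq> {}" using that cls by blast+
    ultimately show ?thesis by simp
  qed
  show image: "?F ` carrier Q = f ` carrier M"
  proof
    show "?F ` carrier Q \<subseteq> f ` carrier M" using F by (auto simp: Q)
    show "f ` carrier M \<subseteq> ?F ` carrier Q"
    proof
      fix R assume "R \<in> f ` carrier M"
      then obtain x where x: "x \<in> carrier M" "R = f x" by blast
      then have "?K `` {x} \<in> carrier Q" "R = ?F (?K `` {x})" using F Q by auto
      then show "R \<in> ?F ` carrier Q" by blast
    qed
  qed
  show "partial_bij_rep Q ?F"
  proof
    fix X Y assume "X \<in> carrier Q" "Y \<in> carrier Q"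
    then obtain x y where xy: "x \<in> carrier M" "y \<in> carrier M" "X = ?K `` {x}" "Y = ?K `` {y}"
      using Q by auto
    then have XY: "X \<cdot>\<^bsub>Q\<^esub> Y = ?K `` {x \<cdot> y}" using mult by simp
    show "X \<cdot>\<^bsub>Q\<^esub> Y \<in> carrier Q" unfolding XY Q using xy closed by blast
    show "?F (X \<cdot>\<^bsub>Q\<^esub> Y) = ?F X O ?F Y"
      unfolding XY using F xy closed hom by simp
  next
    show "inj_on ?F (carrier Q)"
    proof (rule inj_onI)
      fix X Y assume "X \<in> carrier Q" "Y \<in> carrier Q" and eq: "?F X = ?F Y"
      then obtain x y where xy: "x \<in> carrier M" "y \<in> carrier M" "X = ?K `` {x}" "Y = ?K `` {y}"
        using Q by auto
      then have "f x = f y" using F[of x] F[of y] eq by argo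
      then show "X = Y" using xy cls by simp
    qed
  qed (unfold image, rule family)
qed

section \<open>The distributive completion\<close>

text \<open>The pieces may overlap; as parts of \<open>R\<close> they are automatically compatible
  when \<open>R\<close> is a partial bijection.\<close>

definition difference_family :: "'b set set \<Rightarrow> bool" where
  "difference_family I \<longleftrightarrow> (\<forall>R\<in>I. \<forall>Q\<in>I. \<exists>F. finite F \<and> F \<subseteq> I \<and> R - Q = \<Union>F)"

text \<open>The members of \<open>G\<close> are removed one at a time, each breaking every remaining
  piece into finitely many.\<close>

lemma difference_family_Union:
  assumes I: "difference_family I" and F: "finite F" "F \<subseteq> I" and G: "finite G" "G \<subseteq> I"
  shows "\<exists>H. finite H \<and> H \<subseteq> I \<and> \<Union>F - \<Union>G = \<Union>H"
  using G
proof (induction G rule: finite_induct)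
  case empty
  then show ?case using F by auto
next
  case (insert Q G)
  have "G \<subseteq> I" using insert.prems by simp
  from insert.IH[OF this] obtain H where H: "finite H" "H \<subseteq> I" "\<Union>F - \<Union>G = \<Union>H" by blast
  have "Q \<in> I" using insert.prems by simp
  then have "\<exists>E. finite E \<and> E \<subseteq> I \<and> R - Q = \<Union>E" if "R \<in> H" for R
    using I H(2) that by (simp add: difference_family_def subset_iff)
  then obtain E where E: "\<And>R. R \<in> H \<Longrightarrow> finite (E R)" "\<And>R. R \<in> H \<Longrightarrow> E R \<subseteq> I"
      "\<And>R. R \<in> H \<Longrightarrow> R - Q = \<Union>(E R)"
    by metis
  have "\<Union>F - \<Union>(insert Q G) = (\<Union>R\<in>H. R - Q)" using H(3) by auto
  also have "\<dots> = \<Union>(\<Union>R\<in>H. E R)" using E(3) by auto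
  finally have "\<Union>F - \<Union>(insert Q G) = \<Union>(\<Union>R\<in>H. E R)" .
  moreover have "finite (\<Union>R\<in>H. E R)" using E(1) H(1) by simp
  moreover have "(\<Union>R\<in>H. E R) \<subseteq> I" using E(2) by (rule UN_least)
  ultimately show ?case by blast
qed

text \<open>The concrete form of the completion. \<open>F = {}\<close> is allowed and yields the
  zero.\<close>

definition compatible_unions :: "('x \<times> 'x) set set \<Rightarrow> ('x \<times> 'x) set set" where
  "compatible_unions I = {\<Union>F | F. finite F \<and> F \<subseteq> I \<and> partial_bij (\<Union>F)}"

lemma compatible_unionsI:
  "finite F \<Longrightarrow> F \<subseteq> I \<Longrightarrow> partial_bij (\<Union>F) \<Longrightarrow> \<Union>F \<in> compatible_unions I"
  unfolding compatible_unions_def by blast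

lemma partial_bij_family_compatible_unions:
  assumes I: "partial_bij_family I"
  shows "partial_bij_family (compatible_unions I)"
  unfolding partial_bij_family_def
proof (intro conjI ballI)
  show "{} \<in> compatible_unions I" using compatible_unionsI[of "{}" I] by simp
next
  fix R assume "R \<in> compatible_unions I"
  then obtain F where F: "R = \<Union>F" "finite F" "F \<subseteq> I" "partial_bij R"
    by (auto simp: compatible_unions_def)
  then have "R\<inverse> = \<Union>(converse ` F)" by auto
  moreover have "converse ` F \<subseteq> I" using F I by (auto simp: partial_bij_family_def)
  ultimately show "R\<inverse> \<in> compatible_unions I"
    using F compatible_unionsI[of "converse ` F" I] by (metis finite_imageI partial_bij_converse)
  show "partial_bij R" by (rule F)
next
  fix R Q assume "R \<in> compatible_unions I" "Q \<in> compatible_unions I"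
  then obtain F G where F: "R = \<Union>F" "finite F" "F \<subseteq> I" "partial_bij R"
    and G: "Q = \<Union>G" "finite G" "G \<subseteq> I"
    by (auto simp: compatible_unions_def)
  let ?H = "(\<lambda>(R, Q). R \<inter> Q) ` (F \<times> G)"
  have "R \<inter> Q = \<Union>?H" using F G by auto
  moreover have "?H \<subseteq> I"
    using F(3) G(3) I by (auto simp: partial_bij_family_def subset_iff)
  moreover have "partial_bij (R \<inter> Q)" using F(4) by (rule partial_bij_subset) simp
  ultimately show "R \<inter> Q \<in> compatible_unions I"
    using F G compatible_unionsI[of ?H I] by simp
qed

locale completable_rep = partial_bij_rep +
  assumes difference: "difference_family (\<phi> ` carrier S)"
begin

text \<open>If \<open>a\<close> is not covered by \<open>Y\<close>, the uncovered part is a finite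
  union of maps from the image, and a non-empty one of them is an element below \<open>a\<close>
  whose meet with every member of \<open>Y\<close> is zero. Finiteness of \<open>Y\<close> is what
  makes the uncovered part decomposable.\<close>

lemma arrow_iff:
  assumes X: "X \<subseteq> carrier S" and Y: "Y \<subseteq> carrier S" "finite Y"
  shows "arrow S X Y \<longleftrightarrow> \<Union>(\<phi> ` X) \<subseteq> \<Union>(\<phi> ` Y)"
proof
  assume arr: "arrow S X Y"
  have "\<phi> a \<subseteq> \<Union>(\<phi> ` Y)" if a: "a \<in> X" for a
  proof (rule ccontr)
    assume n: "\<not> \<phi> a \<subseteq> \<Union>(\<phi> ` Y)"
    have "\<exists>H. finite H \<and> H \<subseteq> \<phi> ` carrier S \<and> \<Union>{\<phi> a} - \<Union>(\<phi> ` Y) = \<Union>H"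
      using a X Y by (intro difference_family_Union difference) auto
    then obtain H where "H \<subseteq> \<phi> ` carrier S" "\<Union>{\<phi> a} - \<Union>(\<phi> ` Y) = \<Union>H" by blast
    then have H: "H \<subseteq> \<phi> ` carrier S" "\<phi> a - \<Union>(\<phi> ` Y) = \<Union>H" by simp_all
    have "\<phi> a - \<Union>(\<phi> ` Y) \<noteq> {}" using n by simp
    then have "\<Union>H \<noteq> {}" unfolding H(2) .
    then obtain R where R: "R \<in> H" "R \<noteq> {}" by auto
    then obtain x where x: "x \<in> carrier S" "\<phi> x = R" using H(1) by auto
    have xa: "\<phi> x \<subseteq> \<phi> a - \<Union>(\<phi> ` Y)" unfolding H(2) x(2) using R(1) by (rule Union_upper)
    then have "x \<sqsubseteq>\<^bsub>nat_order S\<^esub> a" using x a X by (subst le_iff) auto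
    moreover have "x \<noteq> zero_of S" using x R by (simp add: eq_zero_iff)
    ultimately obtain b where b: "b \<in> Y" "x \<sqinter>\<^bsub>nat_order S\<^esub> b \<noteq> zero_of S"
      using arr a x(1) unfolding arrow_def by blast
    then have "\<phi> x \<inter> \<phi> b \<noteq> {}" using meet[of x b] eq_zero_iff x Y by (metis subsetD)
    then show False using xa b by blast
  qed
  then show "\<Union>(\<phi> ` X) \<subseteq> \<Union>(\<phi> ` Y)" by blast
next
  assume sub: "\<Union>(\<phi> ` X) \<subseteq> \<Union>(\<phi> ` Y)"
  show "arrow S X Y"
    unfolding arrow_def
  proof (intro ballI impI)
    fix a x assume a: "a \<in> X" and x: "x \<in> carrier S" "x \<sqsubseteq>\<^bsub>nat_order S\<^esub> a" "x \<noteq> zero_of S"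
    have "\<phi> x \<subseteq> \<phi> a" using a x X le_iff by blast
    moreover have "\<phi> x \<noteq> {}" using x by (simp add: eq_zero_iff)
    ultimately obtain b where b: "b \<in> Y" "\<phi> x \<inter> \<phi> b \<noteq> {}" using sub a by blast
    then have "x \<sqinter>\<^bsub>nat_order S\<^esub> b \<noteq> zero_of S"
      using meet[of x b] eq_zero_iff x Y by (metis subsetD)
    then show "\<exists>b\<in>Y. x \<sqinter>\<^bsub>nat_order S\<^esub> b \<noteq> zero_of S" using b by blast
  qed
qed

lemma biarrow_iff:
  assumes "X \<subseteq> carrier S" "finite X" "Y \<subseteq> carrier S" "finite Y"
  shows "biarrow S X Y \<longleftrightarrow> \<Union>(\<phi> ` X) = \<Union>(\<phi> ` Y)"
  using assms by (auto simp: biarrow_def arrow_iff)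

text \<open>Since \<open>\<phi>\<close> is injective, this relation is equality; written as a kernel
  it fits the general lemma on kernel quotients.\<close>

lemma biarrow_rel_eq: "biarrow_rel S = kernel_rel S \<phi>"
  unfolding biarrow_rel_def kernel_rel_def by (auto simp: biarrow_iff)

text \<open>The image is unchanged, so whatever is proved for \<open>S\<close> in this locale can be
  repeated for its separative quotient.\<close>

lemma separative_quotient_rep: "completable_rep (separative_quotient S) (\<lambda>X. \<Union>(\<phi> ` X))"
  and separative_quotient_image:
    "(\<lambda>X. \<Union>(\<phi> ` X)) ` carrier (separative_quotient S) = \<phi> ` carrier S"
proof -
  note image = kernel_quotient_image[OF mul_closed hom family, folded biarrow_rel_eq separative_quotient_def]
  note rep = kernel_quotient_rep[OF mul_closed hom family, folded biarrow_rel_eq separative_quotient_def]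
  show "(\<lambda>X. \<Union>(\<phi> ` X)) ` carrier (separative_quotient S) = \<phi> ` carrier S"
    by (rule image)
  show "completable_rep (separative_quotient S) (\<lambda>X. \<Union>(\<phi> ` X))"
    using rep difference by (simp add: completable_rep_def completable_rep_axioms_def image)
qed

lemma Union_order_ideal:
  assumes "X \<subseteq> carrier S"
  shows "\<Union>(\<phi> ` order_ideal S X) = \<Union>(\<phi> ` X)"
proof
  show "\<Union>(\<phi> ` order_ideal S X) \<subseteq> \<Union>(\<phi> ` X)"
    using assms le_iff by (fastforce simp: order_ideal_def)
  have "X \<subseteq> order_ideal S X" using assms le_iff by (auto simp: order_ideal_def)
  then show "\<Union>(\<phi> ` X) \<subseteq> \<Union>(\<phi> ` order_ideal S X)" by blast
qed

lemma finite_compatible_mult: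
  assumes X: "finite_compatible S X" and Y: "finite_compatible S Y"
  defines "Z \<equiv> (\<lambda>(x, y). x \<cdot> y) ` (X \<times> Y)"
  shows "finite_compatible S Z" "\<Union>(\<phi> ` Z) = \<Union>(\<phi> ` X) O \<Union>(\<phi> ` Y)"
proof -
  have X': "X \<subseteq> carrier S" "finite X" "X \<noteq> {}" "partial_bij (\<Union>(\<phi> ` X))"
    and Y': "Y \<subseteq> carrier S" "finite Y" "Y \<noteq> {}" "partial_bij (\<Union>(\<phi> ` Y))"
    using X Y by (auto simp: finite_compatible_iff)
  have "\<Union>(\<phi> ` Z) = (\<Union>x\<in>X. \<Union>y\<in>Y. \<phi> (x \<cdot> y))" by (auto simp: Z_def)
  also have "\<dots> = (\<Union>x\<in>X. \<Union>y\<in>Y. \<phi> x O \<phi> y)"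
    using X'(1) Y'(1) by (intro SUP_cong refl hom) auto
  also have "\<dots> = \<Union>(\<phi> ` X) O \<Union>(\<phi> ` Y)" by auto
  finally show U: "\<Union>(\<phi> ` Z) = \<Union>(\<phi> ` X) O \<Union>(\<phi> ` Y)" .
  have "Z \<subseteq> carrier S" using X' Y' mul_closed by (auto simp: Z_def)
  then show "finite_compatible S Z"
    unfolding finite_compatible_iff U using X' Y' by (auto simp: Z_def partial_bij_relcomp)
qed

text \<open>An element below \<open>a b\<close> is \<open>(a b) e = a (b e)\<close>, and
  \<open>b e\<close> lies below \<open>b\<close>: the idempotent is absorbed by the second
  factor.\<close>

lemma order_ideal_mult:
  assumes X: "X \<subseteq> carrier S" and Y: "Y \<subseteq> carrier S"
  shows "{x \<cdot> y | x y. x \<in> order_ideal S X \<and> y \<in> order_ideal S Y} =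
    order_ideal S ((\<lambda>(x, y). x \<cdot> y) ` (X \<times> Y))" (is "?L = ?R")
proof
  show "?L \<subseteq> ?R"
  proof
    fix z assume "z \<in> ?L"
    then obtain x y a b where z: "z = x \<cdot> y" "x \<in> carrier S" "y \<in> carrier S"
      and ab: "a \<in> X" "b \<in> Y" "x \<sqsubseteq>\<^bsub>nat_order S\<^esub> a" "y \<sqsubseteq>\<^bsub>nat_order S\<^esub> b"
      unfolding order_ideal_def by blast
    have ab': "a \<in> carrier S" "b \<in> carrier S" using ab X Y by auto
    then have "\<phi> x \<subseteq> \<phi> a" "\<phi> y \<subseteq> \<phi> b" using ab z le_iff by blast+
    then have "\<phi> z \<subseteq> \<phi> (a \<cdot> b)" using z ab' by (simp add: hom relcomp_mono)
    then have "z \<sqsubseteq>\<^bsub>nat_order S\<^esub> a \<cdot> b" using z ab' by (simp add: le_iff mul_closed)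
    then show "z \<in> ?R" using z ab by (auto simp: order_ideal_def mul_closed)
  qed
  show "?R \<subseteq> ?L"
  proof
    fix z assume "z \<in> ?R"
    then obtain a b where ab: "a \<in> X" "b \<in> Y" and z: "z \<in> carrier S" "z \<sqsubseteq>\<^bsub>nat_order S\<^esub> a \<cdot> b"
      by (auto simp: order_ideal_def)
    have ab': "a \<in> carrier S" "b \<in> carrier S" using ab X Y by auto
    obtain e where e: "e \<in> idems S" "z = a \<cdot> b \<cdot> e" using z(2) by (auto simp: nat_order_def)
    then have e': "e \<in> carrier S" "\<phi> e \<subseteq> Id" by (auto simp: idems_iff)
    have "z = a \<cdot> (b \<cdot> e)" using e(2) e' ab' by (simp add: eq_iff mul_closed hom O_assoc)
    moreover have "b \<cdot> e \<sqsubseteq>\<^bsub>nat_order S\<^esub> b" using e(1) by (auto simp: nat_order_def)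
    moreover have "a \<sqsubseteq>\<^bsub>nat_order S\<^esub> a" using ab' by (simp add: le_iff)
    ultimately show "z \<in> ?L" using ab ab' e' mul_closed unfolding order_ideal_def by blast
  qed
qed

text \<open>Sending an ideal to the union of its maps turns multiplication of ideals into
  composition and \<open>FC_rel\<close> into a kernel. The completion uses this with the separative
  quotient in place of \<open>S\<close>.\<close>

lemma FC_quotient_rep:
  "partial_bij_rep (quotient_magma (FC S) (FC_rel S)) (\<lambda>c. \<Union>((\<lambda>I. \<Union>(\<phi> ` I)) ` c))" (is "partial_bij_rep ?Q ?\<Phi>")
  and FC_quotient_image:
  "(\<lambda>c. \<Union>((\<lambda>I. \<Union>(\<phi> ` I)) ` c)) ` carrier (quotient_magma (FC S) (FC_rel S)) =
    compatible_unions (\<phi> ` carrier S)"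
proof -
  let ?f = "\<lambda>I. \<Union>(\<phi> ` I)"
  have C: "I \<in> carrier (FC S) \<longleftrightarrow> (\<exists>X. finite_compatible S X \<and> I = order_ideal S X)" for I
    by (auto simp: FC_def)
  have f: "?f (order_ideal S X) = ?f X" if "finite_compatible S X" for X
    using that by (intro Union_order_ideal) (simp add: finite_compatible_iff)
  have mult: "order_ideal S X \<cdot>\<^bsub>FC S\<^esub> order_ideal S Y = order_ideal S ((\<lambda>(x, y). x \<cdot> y) ` (X \<times> Y))"
    if "finite_compatible S X" "finite_compatible S Y" for X Y
    using that order_ideal_mult[of X Y] by (simp add: finite_compatible_iff FC_def)
  have closed: "I \<cdot>\<^bsub>FC S\<^esub> J \<in> carrier (FC S)" and hom': "?f (I \<cdot>\<^bsub>FC S\<^esub> J) = ?f I O ?f J"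
    if IJ: "I \<in> carrier (FC S)" "J \<in> carrier (FC S)" for I J
  proof -
    obtain X Y where XY: "finite_compatible S X" "I = order_ideal S X"
      "finite_compatible S Y" "J = order_ideal S Y" using IJ unfolding C by blast
    note Z = finite_compatible_mult[OF XY(1,3)]
    show "I \<cdot>\<^bsub>FC S\<^esub> J \<in> carrier (FC S)"
      unfolding C XY(2,4) mult[OF XY(1,3)] using Z(1) by blast
    show "?f (I \<cdot>\<^bsub>FC S\<^esub> J) = ?f I O ?f J"
      unfolding XY(2,4) mult[OF XY(1,3)] f[OF XY(1)] f[OF XY(3)] f[OF Z(1)] by (rule Z(2))
  qed
  have image: "?f ` carrier (FC S) = compatible_unions (\<phi> ` carrier S)"
  proof
    show "?f ` carrier (FC S) \<subseteq> compatible_unions (\<phi> ` carrier S)"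
    proof
      fix R assume "R \<in> ?f ` carrier (FC S)"
      then obtain X where X: "finite_compatible S X" "R = ?f X"
        unfolding image_iff bex_simps using C f by metis
      then show "R \<in> compatible_unions (\<phi> ` carrier S)"
        using compatible_unionsI[of "\<phi> ` X" "\<phi> ` carrier S"] by (auto simp: finite_compatible_iff)
    qed
    show "compatible_unions (\<phi> ` carrier S) \<subseteq> ?f ` carrier (FC S)"
    proof
      fix R assume "R \<in> compatible_unions (\<phi> ` carrier S)"
      then obtain F where F: "R = \<Union>F" "finite F" "F \<subseteq> \<phi> ` carrier S" "partial_bij R"
        by (auto simp: compatible_unions_def)
      then obtain X where X: "X \<subseteq> carrier S" "finite X" "F = \<phi> ` X"
        by (metis finite_subset_image)
      \<comment> \<open>\<open>finite_compatible\<close> asks for a non-empty set while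
        \<open>F\<close> may be empty; adjoining the zero repairs this without changing the
        union.\<close>
      then have U: "?f (insert (zero_of S) X) = R" using F zero by simp
      then have fc: "finite_compatible S (insert (zero_of S) X)"
        unfolding finite_compatible_iff U using X F zero by auto
      then have "R = ?f (order_ideal S (insert (zero_of S) X))" using f U by metis
      then show "R \<in> ?f ` carrier (FC S)" using fc C by blast
    qed
  qed
  have rel: "FC_rel S = kernel_rel (FC S) ?f"
  proof
    show "FC_rel S \<subseteq> kernel_rel (FC S) ?f"
    proof
      fix p assume "p \<in> FC_rel S"
      then obtain X Y where p: "p = (order_ideal S X, order_ideal S Y)"
        "finite_compatible S X" "finite_compatible S Y" "biarrow S X Y"
        by (auto simp: FC_rel_def)
      then have "?f X = ?f Y" by (simp add: biarrow_iff finite_compatible_iff)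
      then show "p \<in> kernel_rel (FC S) ?f" using p C f by (auto simp: kernel_rel_def)
    qed
    show "kernel_rel (FC S) ?f \<subseteq> FC_rel S"
    proof
      fix p assume p: "p \<in> kernel_rel (FC S) ?f"
      obtain X Y where p': "p = (order_ideal S X, order_ideal S Y)"
        "finite_compatible S X" "finite_compatible S Y"
        using p unfolding kernel_rel_def C by blast
      then have "?f X = ?f Y" using p f by (simp add: kernel_rel_def)
      then have "biarrow S X Y" using p' by (simp add: biarrow_iff finite_compatible_iff)
      then show "p \<in> FC_rel S" using p' by (auto simp: FC_rel_def)
    qed
  qed
  have fam: "partial_bij_family (?f ` carrier (FC S))"
    unfolding image by (rule partial_bij_family_compatible_unions[OF family])
  show "partial_bij_rep ?Q ?\<Phi>"
    unfolding rel by (rule kernel_quotient_rep[OF closed hom' fam])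
  show "?\<Phi> ` carrier ?Q = compatible_unions (\<phi> ` carrier S)"
    unfolding rel using kernel_quotient_image[OF closed hom' fam] image by simp
qed

text \<open>The map \<open>\<Phi>\<close> is an iterated union over nested classes; only its image
  and the locale properties are passed on.\<close>

lemma obtain_completion_rep:
  obtains \<Phi> where "boolean_partial_bij_rep (distributive_completion S) \<Phi>"
    and "\<Phi> ` carrier (distributive_completion S) = compatible_unions (\<phi> ` carrier S)"
proof -
  let ?I = "\<phi> ` carrier S" and ?D = "distributive_completion S"
  interpret sep: completable_rep "separative_quotient S" "\<lambda>X. \<Union>(\<phi> ` X)"
    by (rule separative_quotient_rep)
  note rep = sep.FC_quotient_rep[folded distributive_completion_def]
  note image = sep.FC_quotient_image[folded distributive_completion_def,
      unfolded separative_quotient_image]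
  obtain \<Phi> where rep: "partial_bij_rep ?D \<Phi>" and image: "\<Phi> ` carrier ?D = compatible_unions ?I"
    using rep image by blast
  have "R \<union> Q \<in> compatible_unions ?I"
    if RQ: "R \<in> compatible_unions ?I" "Q \<in> compatible_unions ?I" "partial_bij (R \<union> Q)" for R Q
  proof -
    obtain F G where "R = \<Union>F" "finite F" "F \<subseteq> ?I" "Q = \<Union>G" "finite G" "G \<subseteq> ?I"
      using RQ(1,2) unfolding compatible_unions_def by blast
    then show ?thesis using compatible_unionsI[of "F \<union> G" ?I] RQ(3) by simp
  qed
  moreover have "R - Q \<in> compatible_unions ?I"
    if RQ: "R \<in> compatible_unions ?I" "Q \<in> compatible_unions ?I" for R Q
  proof -
    obtain F G where FG: "R = \<Union>F" "finite F" "F \<subseteq> ?I" "Q = \<Union>G" "finite G" "G \<subseteq> ?I"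
      and R: "partial_bij R"
      using RQ unfolding compatible_unions_def by blast
    have "\<exists>H. finite H \<and> H \<subseteq> ?I \<and> \<Union>F - \<Union>G = \<Union>H"
      using FG by (intro difference_family_Union difference) auto
    then obtain H where H: "finite H" "H \<subseteq> ?I" "R - Q = \<Union>H" unfolding FG(1,4) by blast
    \<comment> \<open>The pieces are compatible because their union stays inside the partial
      bijection \<open>R\<close>.\<close>
    have "partial_bij (R - Q)" using R by (rule partial_bij_subset) blast
    then show ?thesis using compatible_unionsI[of H ?I] H by simp
  qed
  ultimately have "boolean_partial_bij_rep ?D \<Phi>"
    using rep by (simp add: boolean_partial_bij_rep_def boolean_partial_bij_rep_axioms_def
        flip: image)
  then show thesis using that image by blast
qed

end

section \<open>Prefix replacement on aperiodic streams\<close>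

text \<open>Equal tails at two different positions amount to eventual periodicity, so injectivity of
  the tails excludes exactly that.\<close>

definition aperiodic :: "nat \<Rightarrow> nat stream set" where
  "aperiodic n = {w \<in> streams {1..n}. inj (\<lambda>k. sdrop k w)}"

lemma sdrop_length_shift: "sdrop (k + length u) (u @- w) = sdrop k w"
  by (simp add: sdrop_shift)

text \<open>Eventual periodicity concerns tails only; a finite prefix neither creates nor removes
  it.\<close>

lemma shift_mem_aperiodic_iff: "u @- w \<in> aperiodic n \<longleftrightarrow> u \<in> lists {1..n} \<and> w \<in> aperiodic n"
proof -
  have "inj (\<lambda>k. sdrop k (u @- w)) \<longleftrightarrow> inj (\<lambda>k. sdrop k w)"
  proof
    assume inj: "inj (\<lambda>k. sdrop k (u @- w))"
    show "inj (\<lambda>k. sdrop k w)"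
    proof (rule injI)
      fix j k assume "sdrop j w = sdrop k w"
      then have "sdrop (j + length u) (u @- w) = sdrop (k + length u) (u @- w)"
        by (simp only: sdrop_length_shift)
      then show "j = k" using injD[OF inj] by fastforce
    qed
  next
    assume inj: "inj (\<lambda>k. sdrop k w)"
    show "inj (\<lambda>k. sdrop k (u @- w))"
    proof (rule injI)
      fix j k assume "sdrop j (u @- w) = sdrop k (u @- w)"
      then have "sdrop (length u) (sdrop j (u @- w)) = sdrop (length u) (sdrop k (u @- w))" by simp
      then have "sdrop j w = sdrop k w" by (simp only: sdrop_add sdrop_length_shift)
      then show "j = k" using injD[OF inj] by blast
    qed
  qed
  then show ?thesis by (auto simp: aperiodic_def streams_iff_sset)
qed

text \<open>If the lengths differed, \<open>w\<close> would coincide with one of its proper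
  tails.\<close>

lemma aperiodic_shift_cancel:
  assumes w: "w \<in> aperiodic n" and eq: "p @- w = q @- w"
  shows "p = q"
proof -
  have len: "length q = length p" if "p @- w = q @- w" "length p \<le> length q" for p q
  proof -
    have "sdrop (length q - length p) w = sdrop (length q) (p @- w)"
      using that(2) by (simp add: sdrop_shift)
    also have "\<dots> = sdrop 0 w" unfolding that(1) by (simp add: sdrop_shift)
    finally have "length q - length p = 0"
      using w injD[of "\<lambda>k. sdrop k w"] unfolding aperiodic_def by blast
    then show ?thesis using that(2) by simp
  qed
  have "length p = length q" using len[of p q] len[of q p] eq by (metis nat_le_linear)
  moreover have "p = stake (length p) (p @- w)" "q = stake (length q) (q @- w)"
    by (simp_all add: stake_shift)
  ultimately show ?thesis using eq by metis
qed

lemma shift_eq_shift_cases: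
  assumes "u @- w = u' @- w'" "length u \<le> length u'"
  shows "\<exists>z. u' = u @ z \<and> w = z @- w'"
  using assms
proof (induction u arbitrary: u')
  case (Cons a u)
  then show ?case by (cases u') auto
qed simp

lemma aperiodic_nonempty:
  assumes "n \<ge> 2"
  shows "\<exists>w. w \<in> aperiodic n"
proof -
  \<comment> \<open>The letter 1 marks the squares, whose growing gaps rule out periodicity.\<close>
  define w :: "nat stream" where "w = smap (\<lambda>k. if \<exists>m. k = m\<^sup>2 then 1 else 2) nats"
  have w: "w !! k = (if \<exists>m. k = m\<^sup>2 then 1 else 2)" for k
    by (simp add: w_def)
  have False if eq: "sdrop j w = sdrop k w" and "j < k" for j k
  proof -
    \<comment> \<open>Equal tails carry the square \<open>m^2\<close> to a square
      \<open>m^2 + (k - j)\<close>. For \<open>m = k + 1\<close> this lies strictly between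
      \<open>m^2\<close> and \<open>(m + 1)^2\<close>; moreover \<open>m^2 \<ge> j\<close>, so
      position \<open>m^2\<close> belongs to the tail at \<open>j\<close>.\<close>
    define m where "m = k + 1"
    have "m\<^sup>2 \<ge> j" using \<open>j < k\<close> by (simp add: m_def power2_eq_square)
    then have "w !! (k + (m\<^sup>2 - j)) = w !! m\<^sup>2"
      using arg_cong[OF eq, of "\<lambda>s. s !! (m\<^sup>2 - j)"] by (simp add: sdrop_snth)
    then have "\<exists>l. k + (m\<^sup>2 - j) = l\<^sup>2" unfolding w by (auto split: if_splits)
    then obtain l where l: "k + (m\<^sup>2 - j) = l\<^sup>2" by blast
    then have "m\<^sup>2 < l\<^sup>2" "l\<^sup>2 < (m + 1)\<^sup>2"
      using \<open>j < k\<close> \<open>m\<^sup>2 \<ge> j\<close> by (simp_all add: m_def power2_eq_square)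
    then have "m < l" "l < m + 1" by (simp_all add: power_less_imp_less_base)
    then show False by simp
  qed
  then have "inj (\<lambda>k. sdrop k w)" by (intro injI) (metis nat_neq_iff)
  moreover have "w \<in> streams {1..n}" using assms by (auto simp: streams_iff_snth w)
  ultimately show ?thesis by (auto simp: aperiodic_def)
qed

text \<open>The partial map of \<open>u v^-1\<close>, read from left to right. Only the tails are
  confined to \<open>{1..n}\<close>, which leaves room for an index as the first letter of
  \<open>u\<close> and \<open>v\<close>.\<close>

definition prefix_map :: "nat \<Rightarrow> nat list \<Rightarrow> nat list \<Rightarrow> (nat stream \<times> nat stream) set" where
  "prefix_map n u v = {(u @- w, v @- w) | w. w \<in> aperiodic n}"

lemma prefix_mapI: "w \<in> aperiodic n \<Longrightarrow> (u @- w, v @- w) \<in> prefix_map n u v"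
  by (auto simp: prefix_map_def)

lemma partial_bij_prefix_map: "partial_bij (prefix_map n u v)"
  by (rule partial_bijI) (auto simp: prefix_map_def)

lemma converse_prefix_map: "(prefix_map n u v)\<inverse> = prefix_map n v u"
  by (auto simp: prefix_map_def)

lemma prefix_map_subset_Id: "prefix_map n u u \<subseteq> Id"
  by (auto simp: prefix_map_def)

lemma prefix_map_nonempty: "n \<ge> 2 \<Longrightarrow> prefix_map n u v \<noteq> {}"
  using aperiodic_nonempty by (auto simp: prefix_map_def)

lemma prefix_map_append_subset:
  "z \<in> lists {1..n} \<Longrightarrow> prefix_map n (u @ z) (v @ z) \<subseteq> prefix_map n u v"
  unfolding prefix_map_def using shift_mem_aperiodic_iff by fastforce

text \<open>With the next lemma, these are the two non-zero cases of the multiplication rule for the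
  elements \<open>y x^-1\<close>: one inner word extends the other by \<open>z\<close>.\<close>

lemma prefix_map_relcomp_append1:
  "z \<in> lists {1..n} \<Longrightarrow> prefix_map n u v O prefix_map n (v @ z) t = prefix_map n (u @ z) t"
  unfolding prefix_map_def using shift_mem_aperiodic_iff[of z] by (auto; fastforce)

lemma prefix_map_relcomp_append2:
  "z \<in> lists {1..n} \<Longrightarrow> prefix_map n u (v @ z) O prefix_map n v t = prefix_map n u (t @ z)"
  using arg_cong[OF prefix_map_relcomp_append1[of z n t v u], of converse]
  by (simp add: converse_relcomp converse_prefix_map)

text \<open>At a common point, comparing the first components gives, say, \<open>u' = u @ z\<close>;
  then \<open>v @ z\<close> and \<open>v'\<close> stand in front of the same tail. Cancelling this
  tail is the step that requires aperiodicity.\<close>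

lemma prefix_map_meet_cases:
  assumes "prefix_map n u v \<inter> prefix_map n u' v' \<noteq> {}"
  obtains z where "z \<in> lists {1..n}" "u' = u @ z" "v' = v @ z"
    | z where "z \<in> lists {1..n}" "u = u' @ z" "v = v' @ z"
proof -
  have *: "\<exists>z\<in>lists {1..n}. u' = u @ z \<and> v' = v @ z"
    if h: "u @- w = u' @- w'" "v @- w = v' @- w'" "w \<in> aperiodic n" "w' \<in> aperiodic n"
      "length u \<le> length u'" for u v u' v' w w'
  proof -
    obtain z where z: "u' = u @ z" "w = z @- w'"
      using shift_eq_shift_cases[OF h(1,5)] by blast
    then have "(v @ z) @- w' = v' @- w'" using h(2) by simp
    then have "v' = v @ z" using aperiodic_shift_cancel[OF h(4)] by metis
    moreover have "z \<in> lists {1..n}" using h(3) z(2) shift_mem_aperiodic_iff by blast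
    ultimately show ?thesis using z by blast
  qed
  obtain w w' where w: "w \<in> aperiodic n" "w' \<in> aperiodic n"
    "u @- w = u' @- w'" "v @- w = v' @- w'"
    using assms by (auto simp: prefix_map_def)
  show thesis
  proof (cases "length u \<le> length u'")
    case True
    then show ?thesis using *[OF w(3,4,1,2)] that(1) by blast
  next
    case False
    then show ?thesis using *[OF w(3,4)[symmetric] w(2,1)] that(2) by auto
  qed
qed

text \<open>A letter \<open>d\<close> different from the first letter of \<open>z\<close> gives
  points in the cylinder of \<open>u\<close> that avoid the cylinder of \<open>u @ z\<close>; this
  is where a second letter is required.\<close>

lemma prefix_map_append_eq:
  assumes "n \<ge> 2" "prefix_map n u v \<subseteq> prefix_map n (u @ z) (v @ z)"
  shows "z = []"
proof (rule ccontr)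
  assume "z \<noteq> []"
  then obtain c z' where z: "z = c # z'" by (cases z) auto
  define d :: nat where "d = (if c = 1 then 2 else 1)"
  have d: "d \<in> {1..n}" "d \<noteq> c" using assms(1) by (simp_all add: d_def)
  obtain w where "w \<in> aperiodic n" using aperiodic_nonempty assms by blast
  then have "[d] @- w \<in> aperiodic n" using d by (subst shift_mem_aperiodic_iff) simp
  then have "(u @- [d] @- w, v @- [d] @- w) \<in> prefix_map n (u @ z) (v @ z)"
    using assms(2) prefix_mapI by blast
  then show False using d z by (auto simp: prefix_map_def)
qed

lemma prefix_map_inject:
  assumes "n \<ge> 2" "prefix_map n u v = prefix_map n u' v'"
  shows "u = u' \<and> v = v'"
proof -
  have "prefix_map n u v \<inter> prefix_map n u' v' \<noteq> {}"
    using assms prefix_map_nonempty by auto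
  then show ?thesis
  proof (cases rule: prefix_map_meet_cases)
    case (1 z)
    then have "z = []" using prefix_map_append_eq[of n u v z] assms by simp
    then show ?thesis using 1 by simp
  next
    case (2 z)
    then have "z = []" using prefix_map_append_eq[of n u' v' z] assms by simp
    then show ?thesis using 2 by simp
  qed
qed

section \<open>Intersections and differences of prefix maps\<close>

text \<open>\<open>W\<close> will be the words over the alphabet for the polycyclic monoid, and the
  indexed words for its Brandt extension.\<close>

definition prefix_family :: "nat \<Rightarrow> nat list set \<Rightarrow> (nat stream \<times> nat stream) set set" where
  "prefix_family n W = insert {} {prefix_map n u v | u v. u \<in> W \<and> v \<in> W}"

lemma prefix_family_cases:
  assumes "R \<in> prefix_family n W"
  obtains "R = {}" | u v where "u \<in> W" "v \<in> W" "R = prefix_map n u v"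
  using assms by (auto simp: prefix_family_def)

lemma prefix_map_in_family: "u \<in> W \<Longrightarrow> v \<in> W \<Longrightarrow> prefix_map n u v \<in> prefix_family n W"
  by (auto simp: prefix_family_def)

text \<open>Overlapping prefix maps are nested, so an intersection is empty or one of the
  two.\<close>

lemma partial_bij_family_prefix_family: "partial_bij_family (prefix_family n W)"
  unfolding partial_bij_family_def
proof (intro conjI ballI)
  show "{} \<in> prefix_family n W" by (simp add: prefix_family_def)
next
  fix R assume "R \<in> prefix_family n W"
  then show "partial_bij R"
    by (cases rule: prefix_family_cases) (simp_all add: partial_bij_prefix_map)
  show "R\<inverse> \<in> prefix_family n W"
    using \<open>R \<in> prefix_family n W\<close>
    by (cases rule: prefix_family_cases)
      (simp_all add: converse_prefix_map prefix_map_in_family, simp add: prefix_family_def)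
next
  fix R Q assume R: "R \<in> prefix_family n W" and Q: "Q \<in> prefix_family n W"
  show "R \<inter> Q \<in> prefix_family n W"
  proof (cases "R \<inter> Q = {}")
    case False
    then obtain u v u' v' where *: "R = prefix_map n u v" "Q = prefix_map n u' v'"
      using R Q by (auto elim!: prefix_family_cases)
    have "R \<inter> Q = Q \<or> R \<inter> Q = R"
      using False[unfolded *]
    proof (cases rule: prefix_map_meet_cases)
      case (1 z)
      then have "Q \<subseteq> R" using * prefix_map_append_subset by simp
      then show ?thesis by blast
    next
      case (2 z)
      then have "R \<subseteq> Q" using * prefix_map_append_subset by simp
      then show ?thesis by blast
    qed
    then show ?thesis using R Q by auto
  qed (simp add: prefix_family_def)
qed

text \<open>Tails are sorted by their first letter. For \<open>u = v = []\<close> this is the Cuntz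
  relation, the identity as the join of the idempotents \<open>a_d a_d^-1\<close>.\<close>

lemma prefix_map_split:
  "prefix_map n u v = (\<Union>d\<in>{1..n}. prefix_map n (u @ [d]) (v @ [d]))"
proof
  show "(\<Union>d\<in>{1..n}. prefix_map n (u @ [d]) (v @ [d])) \<subseteq> prefix_map n u v"
    using prefix_map_append_subset[of "[_]"] by (intro UN_least) simp
  show "prefix_map n u v \<subseteq> (\<Union>d\<in>{1..n}. prefix_map n (u @ [d]) (v @ [d]))"
  proof
    fix p assume "p \<in> prefix_map n u v"
    then obtain w where w: "w \<in> aperiodic n" "p = (u @- w, v @- w)" by (auto simp: prefix_map_def)
    have eq: "w = [shd w] @- stl w" by simp
    then have "shd w \<in> {1..n}" "stl w \<in> aperiodic n"
      using w(1) shift_mem_aperiodic_iff[of "[shd w]" "stl w" n] by simp_all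
    then have "p \<in> prefix_map n (u @ [shd w]) (v @ [shd w])"
      using prefix_mapI[of "stl w" n "u @ [shd w]" "v @ [shd w]"] w(2) by simp
    then show "p \<in> (\<Union>d\<in>{1..n}. prefix_map n (u @ [d]) (v @ [d]))"
      using \<open>shd w \<in> {1..n}\<close> by blast
  qed
qed

text \<open>The witness consists of the siblings along \<open>z\<close>: a proper prefix of
  \<open>z\<close> followed by a letter different from the next one. There are finitely many because
  the alphabet is finite.\<close>

lemma prefix_map_diff:
  assumes "z \<in> lists {1..n}"
  shows "\<exists>Y. finite Y \<and> Y \<subseteq> lists {1..n} \<and>
    prefix_map n u v - prefix_map n (u @ z) (v @ z) = (\<Union>y\<in>Y. prefix_map n (u @ y) (v @ y))"
  using assms
proof (induction z arbitrary: u v)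
  case Nil
  then show ?case by (intro exI[of _ "{}"]) simp
next
  case (Cons c z)
  from Cons.IH[of "u @ [c]" "v @ [c]"] obtain Y where Y: "finite Y" "Y \<subseteq> lists {1..n}"
    "prefix_map n (u @ [c]) (v @ [c]) - prefix_map n (u @ c # z) (v @ c # z) =
      (\<Union>y\<in>Y. prefix_map n (u @ c # y) (v @ c # y))"
    by auto
  let ?P = "\<lambda>y. prefix_map n (u @ y) (v @ y)"
  let ?Z = "(\<lambda>d. [d]) ` ({1..n} - {c}) \<union> (#) c ` Y"
  have c: "c \<in> {1..n}" by (rule Cons.hyps)
  have disj: "?P [d] \<inter> ?P (c # z) = {}" if "d \<noteq> c" for d
    using that by (auto simp: prefix_map_def)
  have "prefix_map n u v = ?P [c] \<union> (\<Union>d\<in>{1..n} - {c}. ?P [d])"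
    using prefix_map_split[of n u v] c by auto
  then have "prefix_map n u v - ?P (c # z) =
      (?P [c] - ?P (c # z)) \<union> ((\<Union>d\<in>{1..n} - {c}. ?P [d]) - ?P (c # z))"
    by (simp only: Un_Diff)
  also have "(\<Union>d\<in>{1..n} - {c}. ?P [d]) - ?P (c # z) = (\<Union>d\<in>{1..n} - {c}. ?P [d])"
    using disj by fastforce
  also have "(?P [c] - ?P (c # z)) \<union> (\<Union>d\<in>{1..n} - {c}. ?P [d]) = (\<Union>y\<in>?Z. ?P y)"
    unfolding Y(3) by (simp add: UN_Un Un_commute)
  finally have "prefix_map n u v - ?P (c # z) = (\<Union>y\<in>?Z. ?P y)" .
  moreover have "finite ?Z" using Y by simp
  moreover have "?Z \<subseteq> lists {1..n}" using Y(2) c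
    by (intro Un_least image_subsetI lists.intros) auto
  ultimately show ?case by blast
qed

lemma difference_family_prefix_family:
  assumes W: "\<And>u z. u \<in> W \<Longrightarrow> z \<in> lists {1..n} \<Longrightarrow> u @ z \<in> W"
  shows "difference_family (prefix_family n W)"
  unfolding difference_family_def
proof (intro ballI)
  fix R Q assume R: "R \<in> prefix_family n W" and Q: "Q \<in> prefix_family n W"
  show "\<exists>F. finite F \<and> F \<subseteq> prefix_family n W \<and> R - Q = \<Union>F"
  proof (cases "R \<inter> Q = {}")
    case True
    then have "R - Q = \<Union>{R}" by auto
    then show ?thesis using R by (intro exI[of _ "{R}"]) auto
  next
    case False
    then obtain u v u' v' where *: "u \<in> W" "v \<in> W" "R = prefix_map n u v" "Q = prefix_map n u' v'"
      using R Q by (auto elim!: prefix_family_cases)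
    show ?thesis
      using False[unfolded *(3,4)]
    proof (cases rule: prefix_map_meet_cases)
      case (1 z)
      obtain Y where Y: "finite Y" "Y \<subseteq> lists {1..n}"
        "R - Q = (\<Union>y\<in>Y. prefix_map n (u @ y) (v @ y))"
        using prefix_map_diff[OF 1(1), of u v] unfolding * 1 by blast
      moreover have "(\<lambda>y. prefix_map n (u @ y) (v @ y)) ` Y \<subseteq> prefix_family n W"
        by (intro image_subsetI prefix_map_in_family W *(1,2)) (erule subsetD[OF Y(2)])+
      ultimately show ?thesis
        by (intro exI[of _ "(\<lambda>y. prefix_map n (u @ y) (v @ y)) ` Y"]) simp
    next
      case (2 z)
      then have "R \<subseteq> Q" using * prefix_map_append_subset by simp
      then have "R - Q = \<Union>{}" by auto
      then show ?thesis by (intro exI[of _ "{}"]) simp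
    qed
  qed
qed

section \<open>The polycyclic monoid\<close>

lemma kernel_congruence:
  fixes M :: "('a, 'c) magma_scheme" (structure)
  assumes closed: "\<And>x y. x \<in> carrier M \<Longrightarrow> y \<in> carrier M \<Longrightarrow> x \<cdot> y \<in> carrier M"
    and hom: "\<And>x y. x \<in> carrier M \<Longrightarrow> y \<in> carrier M \<Longrightarrow> f (x \<cdot> y) = f x O f y"
  shows "semigroup_congruence M (kernel_rel M f)"
  unfolding semigroup_congruence_def
proof
  show "equiv (carrier M) (kernel_rel M f)"
    by (intro equivI refl_onI symI transI) (auto simp: kernel_rel_def)
  show "\<forall>(a, b)\<in>kernel_rel M f. \<forall>c\<in>carrier M.
      (c \<cdot> a, c \<cdot> b) \<in> kernel_rel M f \<and> (a \<cdot> c, b \<cdot> c) \<in> kernel_rel M f"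
    by (auto simp: kernel_rel_def closed hom)
qed

lemma semigroup_congruence_Int:
  assumes "semigroup_congruence M R" "semigroup_congruence M Q"
  shows "semigroup_congruence M (R \<inter> Q)"
proof -
  have "equiv (carrier M) (R \<inter> Q)"
    using assms unfolding semigroup_congruence_def
    by (auto simp: equiv_def refl_on_def intro: sym_Int trans_Int)
  then show ?thesis using assms unfolding semigroup_congruence_def by fast
qed

section \<open>Words acting on streams\<close>

abbreviation letters :: "nat \<Rightarrow> letter set" where
  "letters n \<equiv> Gen ` {1..n} \<union> Gen_inv ` {1..n}"

fun letter_map :: "nat \<Rightarrow> letter \<Rightarrow> (nat stream \<times> nat stream) set" where
  "letter_map n (Gen i) = prefix_map n [i] []"
| "letter_map n (Gen_inv i) = prefix_map n [] [i]"

text \<open>The fold starts from the identity on aperiodic streams rather than from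
  \<open>Id\<close>, so that the empty word acts by a prefix map too.\<close>

definition word_map :: "nat \<Rightarrow> letter list \<Rightarrow> (nat stream \<times> nat stream) set" where
  "word_map n w = foldr (\<lambda>l R. letter_map n l O R) w (prefix_map n [] [])"

definition word0_map :: "nat \<Rightarrow> letter list option \<Rightarrow> (nat stream \<times> nat stream) set" where
  "word0_map n p = (case p of None \<Rightarrow> {} | Some w \<Rightarrow> word_map n w)"

lemma word_map_simps [simp]:
  "word_map n [] = prefix_map n [] []" "word_map n (l # w) = letter_map n l O word_map n w"
  by (simp_all add: word_map_def)

lemma word0_map_simps [simp]: "word0_map n None = {}" "word0_map n (Some w) = word_map n w"
  by (simp_all add: word0_map_def)

lemma prefix_map_Nil_relcomp: "z \<in> lists {1..n} \<Longrightarrow> prefix_map n [] [] O prefix_map n z t = prefix_map n z t"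
  using prefix_map_relcomp_append1[of z n "[]" "[]" t] by simp

lemma prefix_map_Nil_letter_map:
  assumes "l \<in> letters n"
  shows "prefix_map n [] [] O letter_map n l = letter_map n l"
proof (cases l)
  case (Gen i)
  then have "[i] \<in> lists {1..n}" using assms by auto
  then show ?thesis using Gen prefix_map_Nil_relcomp[of "[i]" n "[]"] by simp
next
  case (Gen_inv i)
  then show ?thesis using prefix_map_Nil_relcomp[of "[]" n "[i]"] by simp
qed

lemma word_map_append:
  assumes "v \<in> lists (letters n)"
  shows "word_map n (u @ v) = word_map n u O word_map n v"
proof (induction u)
  case Nil
  show ?case
  proof (cases v)
    case Nil
    then show ?thesis using prefix_map_Nil_relcomp[of "[]" n "[]"] by simp
  next
    case (Cons l v')
    then have "l \<in> letters n" using assms by auto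
    then show ?thesis using Cons by (simp add: O_assoc[symmetric] prefix_map_Nil_letter_map)
  qed
qed (simp add: O_assoc)

text \<open>\<open>rev\<close>, because the inverse of a word lists the inverse letters in the
  opposite order.\<close>

definition normal_form :: "nat list \<Rightarrow> nat list \<Rightarrow> letter list" where
  "normal_form y x = map Gen y @ map Gen_inv (rev x)"

lemma normal_form_in_letters:
  "y \<in> lists {1..n} \<Longrightarrow> x \<in> lists {1..n} \<Longrightarrow> normal_form y x \<in> lists (letters n)"
  by (auto simp: normal_form_def)

lemma word_map_normal_form:
  assumes "y \<in> lists {1..n}" "x \<in> lists {1..n}"
  shows "word_map n (normal_form y x) = prefix_map n y x"
  using assms(1)
proof (induction y)
  case Nil
  show ?case
    using assms(2)
  \<comment> \<open>The last letter of \<open>x\<close> gives the first inverse letter, hence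
    induction from the right end.\<close>
  proof (induction x rule: rev_induct)
    case (snoc a x)
    then have "[a] \<in> lists {1..n}" by simp
    then show ?case
      using snoc prefix_map_relcomp_append2[of "[a]" n "[]" "[]" x] by (simp add: normal_form_def)
  qed (simp add: normal_form_def)
next
  case (Cons i y)
  then show ?case
    using prefix_map_relcomp_append1[of y n "[i]" "[]" x] by (simp add: normal_form_def)
qed

lemma free_monoid0_simps:
  "carrier (free_monoid0 n) = insert None (Some ` lists (letters n))"
  "mul (free_monoid0 n) = word0_mul"
  by (simp_all add: free_monoid0_def)

lemma free_monoid0_closed:
  assumes "p \<in> carrier (free_monoid0 n)" "q \<in> carrier (free_monoid0 n)"
  shows "p \<cdot>\<^bsub>free_monoid0 n\<^esub> q \<in> carrier (free_monoid0 n)"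
  using assms unfolding free_monoid0_simps by (cases p; cases q) (auto simp: inj_image_mem_iff)

lemma word0_map_hom:
  assumes "p \<in> carrier (free_monoid0 n)" "q \<in> carrier (free_monoid0 n)"
  shows "word0_map n (p \<cdot>\<^bsub>free_monoid0 n\<^esub> q) = word0_map n p O word0_map n q"
proof (cases p)
  case (Some u)
  show ?thesis
  proof (cases q)
    fix v assume v: "q = Some v"
    then have "v \<in> lists (letters n)" using assms by (auto simp: free_monoid0_simps simp del: in_lists_conv_set)
    then show ?thesis using Some v by (simp add: free_monoid0_simps word_map_append)
  qed (simp add: Some free_monoid0_simps)
qed (simp add: free_monoid0_simps)

section \<open>Normal forms and the congruence of the presentation\<close>

definition normal_forms :: "nat \<Rightarrow> letter list option set" where
  "normal_forms n = insert None {Some (normal_form y x) | y x. y \<in> lists {1..n} \<and> x \<in> lists {1..n}}"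

text \<open>The word is read from its right end, the part already read being in normal form. A
  generator joins \<open>y\<close>; an inverse generator meets the first letter of \<open>y\<close>,
  where a relation applies, or joins \<open>x\<close> when \<open>y\<close> is empty.\<close>

lemma word_congruent_normal_form:
  assumes R: "semigroup_congruence (free_monoid0 n) R" and rels: "polycyclic_relations n \<subseteq> R"
    and w: "w \<in> lists (letters n)"
  shows "\<exists>t\<in>normal_forms n. (Some w, t) \<in> R"
  using w
proof (induction w rule: lists.induct)
  case Nil
  have "Some [] \<in> carrier (free_monoid0 n)" by (simp add: free_monoid0_simps)
  then have "(Some [], Some []) \<in> R"
    using R unfolding semigroup_congruence_def equiv_def by (auto dest: refl_onD)
  moreover have "Some [] \<in> normal_forms n"
    unfolding normal_forms_def normal_form_def by force
  ultimately show ?case by blast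
next
  case (Cons l w)
  have left: "(Some (v @ u), word0_mul (Some v) t) \<in> R"
    and right: "(Some (u @ v), word0_mul t (Some v)) \<in> R"
    if ut: "(Some u, t) \<in> R" and v: "v \<in> lists (letters n)" for u v t
  proof -
    have "Some v \<in> carrier (free_monoid0 n)" unfolding free_monoid0_simps using v by blast
    then have "(Some v \<cdot>\<^bsub>free_monoid0 n\<^esub> Some u, Some v \<cdot>\<^bsub>free_monoid0 n\<^esub> t) \<in> R"
      "(Some u \<cdot>\<^bsub>free_monoid0 n\<^esub> Some v, t \<cdot>\<^bsub>free_monoid0 n\<^esub> Some v) \<in> R"
      using R ut unfolding semigroup_congruence_def by blast+
    then show "(Some (v @ u), word0_mul (Some v) t) \<in> R" "(Some (u @ v), word0_mul t (Some v)) \<in> R"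
      by (simp_all add: free_monoid0_simps)
  qed
  have R_trans: "(p, q) \<in> R \<Longrightarrow> (q, t) \<in> R \<Longrightarrow> (p, t) \<in> R" for p q t
    using R unfolding semigroup_congruence_def equiv_def by (blast dest: transD)
  obtain t where t: "t \<in> normal_forms n" "(Some w, t) \<in> R" using Cons.IH by blast
  have step: "(Some (l # w), word0_mul (Some [l]) t) \<in> R"
    using left[OF t(2), of "[l]"] Cons.hyps by auto
  show ?case
  proof (cases t)
    case None
    then show ?thesis using step by (auto simp: normal_forms_def)
  next
    case (Some t')
    then obtain y x where yx: "t' = normal_form y x" "y \<in> lists {1..n}" "x \<in> lists {1..n}"
      using t(1) by (auto simp: normal_forms_def)
    have step: "(Some (l # w), Some (l # normal_form y x)) \<in> R"
      using step Some yx by simp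
    have nf: "Some (normal_form y x) \<in> normal_forms n"
      if "y \<in> lists {1..n}" "x \<in> lists {1..n}" for y x
      using that unfolding normal_forms_def by blast
    show ?thesis
    proof (cases l)
      case (Gen i)
      then have "i \<in> {1..n}" using Cons.hyps by auto
      then have "Some (normal_form (i # y) x) \<in> normal_forms n" using yx by (intro nf lists.intros)
      moreover have "l # normal_form y x = normal_form (i # y) x" by (simp add: Gen normal_form_def)
      ultimately show ?thesis using step by metis
    next
      case (Gen_inv i)
      then have i: "i \<in> {1..n}" using Cons.hyps by auto
      show ?thesis
      proof (cases y)
        case Nil
        \<comment> \<open>The leading letter of the inverse part belongs to the end of
          \<open>x\<close>, hence \<open>x @ [i]\<close>.\<close>
        have "Some (normal_form [] (x @ [i])) \<in> normal_forms n" using yx i by (intro nf) auto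
        moreover have "l # normal_form y x = normal_form [] (x @ [i])"
          by (simp add: Gen_inv Nil normal_form_def)
        ultimately show ?thesis using step by metis
      next
        case (Cons j y')
        then have j: "j \<in> {1..n}" "y' \<in> lists {1..n}" using yx by auto
        have eq: "l # normal_form y x = [Gen_inv i, Gen j] @ normal_form y' x"
          by (simp add: Gen_inv Cons normal_form_def)
        have v: "normal_form y' x \<in> lists (letters n)" using yx j by (intro normal_form_in_letters)
        show ?thesis
        proof (cases "i = j")
          case True
          then have "(Some [Gen_inv i, Gen j], Some []) \<in> R"
            using rels i by (auto simp: polycyclic_relations_def)
          from right[OF this v] have "(Some (l # w), Some (normal_form y' x)) \<in> R"
            using R_trans[OF step] by (simp add: eq)
          then show ?thesis using nf j yx by blast
        next
          case False
          then have "(Some [Gen_inv i, Gen j], None) \<in> R"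
            using rels i j by (auto simp: polycyclic_relations_def)
          from right[OF this v] have "(Some (l # w), None) \<in> R"
            using R_trans[OF step] by (simp add: eq)
          then show ?thesis by (auto simp: normal_forms_def)
        qed
      qed
    qed
  qed
qed

lemma congruent_normal_form:
  assumes R: "semigroup_congruence (free_monoid0 n) R" "polycyclic_relations n \<subseteq> R"
    and p: "p \<in> carrier (free_monoid0 n)"
  shows "\<exists>t\<in>normal_forms n. (p, t) \<in> R"
proof (cases p)
  case None
  then have "(p, p) \<in> R" "p \<in> normal_forms n"
    using R p unfolding semigroup_congruence_def equiv_def by (auto dest: refl_onD simp: normal_forms_def)
  then show ?thesis by blast
next
  case (Some w)
  then have "w \<in> lists (letters n)" using p unfolding free_monoid0_simps by blast
  then show ?thesis unfolding Some by (rule word_congruent_normal_form[OF R])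
qed

lemma polycyclic_relations_kernel: "polycyclic_relations n \<subseteq> kernel_rel (free_monoid0 n) (word0_map n)"
proof -
  have "letter_map n (Gen_inv i) O letter_map n (Gen i) = prefix_map n [] []" for i
    by (auto simp: prefix_map_def)
  moreover have "letter_map n (Gen_inv i) O letter_map n (Gen j) = {}" if "i \<noteq> j" for i j
    using that by (auto simp: prefix_map_def)
  ultimately show ?thesis
    by (auto simp: polycyclic_relations_def kernel_rel_def free_monoid0_simps O_assoc[symmetric]
        prefix_map_Nil_relcomp simp del: letter_map.simps)
qed

text \<open>The kernel is a congruence containing the relations. Conversely, every element is
  congruent to a normal form and distinct normal forms act differently, so elements with the same
  action reach the same normal form.\<close>

lemma congruence_kernel_eq:
  assumes n: "n \<ge> 2"
  shows "congruence_generated (free_monoid0 n) (polycyclic_relations n) =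
    kernel_rel (free_monoid0 n) (word0_map n)" (is "?G = ?K")
proof
  have K: "semigroup_congruence (free_monoid0 n) ?K"
    by (rule kernel_congruence[OF free_monoid0_closed word0_map_hom])
  show "?G \<subseteq> ?K"
    unfolding congruence_generated_def using K polycyclic_relations_kernel by blast
  have inj: "t = t'" if t: "t \<in> normal_forms n" "t' \<in> normal_forms n" "word0_map n t = word0_map n t'" for t t'
  proof -
    have *: "t = None \<and> word0_map n t = {} \<or>
        (\<exists>y x. t = Some (normal_form y x) \<and> word0_map n t = prefix_map n y x)"
      if "t \<in> normal_forms n" for t
      using that unfolding normal_forms_def
      by (elim insertE CollectE exE conjE) (metis word0_map_simps word_map_normal_form)+
    show ?thesis
      using *[OF t(1)] *[OF t(2)] t(3) prefix_map_nonempty[OF n] prefix_map_inject[OF n] by metis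
  qed
  show "?K \<subseteq> ?G"
    unfolding congruence_generated_def
  proof (intro Inter_greatest subrelI)
    fix R p q assume "R \<in> {R. semigroup_congruence (free_monoid0 n) R \<and> polycyclic_relations n \<subseteq> R}"
      and pq: "(p, q) \<in> ?K"
    then have R: "semigroup_congruence (free_monoid0 n) R" "polycyclic_relations n \<subseteq> R" by auto
    \<comment> \<open>Reducing modulo the intersection with the kernel preserves the action as well
      as the class under \<open>R\<close>, so the two normal forms can be compared.\<close>
    have RK: "semigroup_congruence (free_monoid0 n) (R \<inter> ?K)" "polycyclic_relations n \<subseteq> R \<inter> ?K"
      using semigroup_congruence_Int[OF R(1) K] R(2) polycyclic_relations_kernel by auto
    have "p \<in> carrier (free_monoid0 n)" "q \<in> carrier (free_monoid0 n)"
      using pq by (auto simp: kernel_rel_def)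
    then obtain t t' where t: "t \<in> normal_forms n" "(p, t) \<in> R \<inter> ?K"
      and t': "t' \<in> normal_forms n" "(q, t') \<in> R \<inter> ?K"
      using congruent_normal_form[OF RK] by meson
    have "word0_map n t = word0_map n t'" using t(2) t'(2) pq by (simp add: kernel_rel_def)
    then have "t = t'" using inj t t' by blast
    then show "(p, q) \<in> R"
      using t t' R(1) unfolding semigroup_congruence_def equiv_def by (blast dest: symD transD)
  qed
qed

lemma word0_map_image:
  assumes "n \<ge> 2"
  shows "word0_map n ` carrier (free_monoid0 n) = prefix_family n (lists {1..n})"
proof
  show "word0_map n ` carrier (free_monoid0 n) \<subseteq> prefix_family n (lists {1..n})"
  proof (rule image_subsetI)
    fix p assume "p \<in> carrier (free_monoid0 n)"
    then obtain t where t: "t \<in> normal_forms n" "(p, t) \<in> kernel_rel (free_monoid0 n) (word0_map n)"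
      using congruent_normal_form[OF kernel_congruence[OF free_monoid0_closed word0_map_hom]
          polycyclic_relations_kernel] by blast
    then have "word0_map n p = word0_map n t" by (simp add: kernel_rel_def)
    moreover have "word0_map n t \<in> prefix_family n (lists {1..n})"
      using t(1) unfolding normal_forms_def
      by (elim insertE CollectE exE conjE)
        (simp add: prefix_family_def, simp add: word_map_normal_form prefix_map_in_family)
    ultimately show "word0_map n p \<in> prefix_family n (lists {1..n})" by simp
  qed
  show "prefix_family n (lists {1..n}) \<subseteq> word0_map n ` carrier (free_monoid0 n)"
  proof
    fix R assume "R \<in> prefix_family n (lists {1..n})"
    then show "R \<in> word0_map n ` carrier (free_monoid0 n)"
    proof (cases rule: prefix_family_cases)
      case 1
      then show ?thesis by (intro image_eqI[of _ _ None]) (simp_all add: free_monoid0_simps)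
    next
      case (2 y x)
      then show ?thesis
        unfolding free_monoid0_simps using normal_form_in_letters[of y n x]
        by (intro image_eqI[of _ _ "Some (normal_form y x)"]) (simp add: word_map_normal_form, blast)
    qed
  qed
qed

lemma polycyclic_rep:
  assumes n: "n \<ge> 2"
  shows "partial_bij_rep (polycyclic n) (\<lambda>m. \<Union>(word0_map n ` m))"
    and polycyclic_image:
      "(\<lambda>m. \<Union>(word0_map n ` m)) ` carrier (polycyclic n) = prefix_family n (lists {1..n})"
proof -
  have fam: "partial_bij_family (word0_map n ` carrier (free_monoid0 n))"
    unfolding word0_map_image[OF n] by (rule partial_bij_family_prefix_family)
  note * = free_monoid0_closed word0_map_hom fam
  show "partial_bij_rep (polycyclic n) (\<lambda>m. \<Union>(word0_map n ` m))"
    unfolding polycyclic_def congruence_kernel_eq[OF n] by (rule kernel_quotient_rep[OF *])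
  show "(\<lambda>m. \<Union>(word0_map n ` m)) ` carrier (polycyclic n) = prefix_family n (lists {1..n})"
    unfolding polycyclic_def congruence_kernel_eq[OF n]
    using kernel_quotient_image[OF *] word0_map_image[OF n] by simp
qed

section \<open>The extended polycyclic semigroup\<close>

text \<open>The indices of \<open>(i, m, j)\<close> become extra first letters, so that \<open>(i, yx\<inverse>, j)\<close> is represented
  by the prefix exchange of \<open>iy\<close> and \<open>jx\<close>.\<close>

definition index_map ::
    "nat \<Rightarrow> nat \<Rightarrow> (nat stream \<times> nat stream) set \<Rightarrow> (nat stream \<times> nat stream) set" where
  "index_map i j R = (\<lambda>(w, w'). (i ## w, j ## w')) ` R"

lemma index_map_relcomp:
  "index_map i j R O index_map k l Q = (if j = k then index_map i l (R O Q) else {})"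
  by (force simp: index_map_def)

lemma index_map_empty_iff [simp]: "index_map i j R = {} \<longleftrightarrow> R = {}"
  by (auto simp: index_map_def)

text \<open>A single pair of streams reveals both indices, which is why \<open>R\<close> has to be
  non-empty.\<close>

lemma index_map_inject:
  assumes "index_map i j R = index_map k l Q" "R \<noteq> {}"
  shows "i = k \<and> j = l \<and> R = Q"
proof -
  obtain w w' where "(w, w') \<in> R" using assms(2) by auto
  then have "(i ## w, j ## w') \<in> index_map k l Q"
    unfolding assms(1)[symmetric] by (force simp: index_map_def)
  then have ij: "i = k" "j = l" by (auto simp: index_map_def)
  have "inj (\<lambda>(w, w'). (i ## w, j ## w'))" by (auto intro: injI)
  then have "R = Q" using assms(1) unfolding ij index_map_def by (metis inj_image_eq_iff)
  with ij show ?thesis by simp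
qed

lemma index_map_prefix_map: "index_map i j (prefix_map n y x) = prefix_map n (i # y) (j # x)"
  by (force simp: index_map_def prefix_map_def)

definition brandt_map ::
    "('a \<Rightarrow> (nat stream \<times> nat stream) set) \<Rightarrow> (nat \<times> 'a \<times> nat) option \<Rightarrow> (nat stream \<times> nat stream) set" where
  "brandt_map \<rho> s = (case s of None \<Rightarrow> {} | Some (i, m, j) \<Rightarrow> index_map i j (\<rho> m))"

lemma brandt_map_simps [simp]:
  "brandt_map \<rho> None = {}" "brandt_map \<rho> (Some (i, m, j)) = index_map i j (\<rho> m)"
  by (simp_all add: brandt_map_def)

text \<open>Indices and letters are both natural numbers; only the position in the word tells them
  apart.\<close>

definition indexed_words :: "nat \<Rightarrow> nat \<Rightarrow> nat list set" where
  "indexed_words n r = {i # y | i y. i \<in> {1..r} \<and> y \<in> lists {1..n}}"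

lemma indexed_wordsI: "i \<in> {1..r} \<Longrightarrow> y \<in> lists {1..n} \<Longrightarrow> i # y \<in> indexed_words n r"
  unfolding indexed_words_def by blast

lemma indexed_words_append: "u \<in> indexed_words n r \<Longrightarrow> z \<in> lists {1..n} \<Longrightarrow> u @ z \<in> indexed_words n r"
  by (auto simp: indexed_words_def)

text \<open>A product of triples vanishes because the inner indices differ or because the product in
  the polycyclic monoid is zero; in both cases the composite map is empty. Injectivity holds because
  the triples have non-empty maps.\<close>

lemma extended_polycyclic_rep:
  assumes n: "n \<ge> 2"
  defines "\<phi> \<equiv> brandt_map (\<lambda>m. \<Union>(word0_map n ` m))"
  shows "completable_rep (extended_polycyclic n r) \<phi>"
    and extended_polycyclic_image:
      "\<phi> ` carrier (extended_polycyclic n r) = prefix_family n (indexed_words n r)"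
proof -
  let ?M = "polycyclic n" and ?P = "extended_polycyclic n r"
  define \<rho> where "\<rho> = (\<lambda>m. \<Union>(word0_map n ` m))"
  have \<phi>: "\<phi> = brandt_map \<rho>" by (simp add: \<phi>_def \<rho>_def)
  interpret M: partial_bij_rep ?M \<rho>
    unfolding \<rho>_def by (rule polycyclic_rep[OF n])
  have M_image: "\<rho> ` carrier ?M = prefix_family n (lists {1..n})"
    unfolding \<rho>_def by (rule polycyclic_image[OF n])
  have C: "s \<in> carrier ?P \<longleftrightarrow> s = None \<or>
      (\<exists>i m j. s = Some (i, m, j) \<and> i \<in> {1..r} \<and> j \<in> {1..r} \<and> m \<in> carrier ?M \<and> \<rho> m \<noteq> {})" for s
  proof -
    have nz: "carrier ?M - {zero_of ?M} = {m \<in> carrier ?M. \<rho> m \<noteq> {}}"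
      using M.eq_zero_iff by blast
    show ?thesis
      unfolding extended_polycyclic_def brandt_def partial_object.simps nz
      by (cases s) (auto simp: inj_image_mem_iff simp del: atLeastAtMost_iff)
  qed
  have closed: "s \<cdot>\<^bsub>?P\<^esub> t \<in> carrier ?P" and hom: "\<phi> (s \<cdot>\<^bsub>?P\<^esub> t) = \<phi> s O \<phi> t"
    if s: "s \<in> carrier ?P" and t: "t \<in> carrier ?P" for s t
  proof -
    have "s \<cdot>\<^bsub>?P\<^esub> t \<in> carrier ?P \<and> \<phi> (s \<cdot>\<^bsub>?P\<^esub> t) = \<phi> s O \<phi> t"
    proof (cases "s = None \<or> t = None")
      case True
      then have "s \<cdot>\<^bsub>?P\<^esub> t = None"
        by (auto simp: extended_polycyclic_def brandt_def split: option.split)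
      then show ?thesis using True by (auto simp: C \<phi>)
    next
      case False
      then obtain i m j k p l where st: "s = Some (i, m, j)" "t = Some (k, p, l)"
        "i \<in> {1..r}" "l \<in> {1..r}" "m \<in> carrier ?M" "p \<in> carrier ?M"
        using s t unfolding C by blast
      then have mp: "m \<cdot>\<^bsub>?M\<^esub> p \<in> carrier ?M" "\<rho> (m \<cdot>\<^bsub>?M\<^esub> p) = \<rho> m O \<rho> p"
        by (simp_all add: M.mul_closed M.hom)
      have st': "s \<cdot>\<^bsub>?P\<^esub> t = (if j = k \<and> \<rho> (m \<cdot>\<^bsub>?M\<^esub> p) \<noteq> {} then Some (i, m \<cdot>\<^bsub>?M\<^esub> p, l) else None)"
        using st mp(1) by (simp add: extended_polycyclic_def brandt_def M.eq_zero_iff)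
      show ?thesis
      proof (cases "j = k \<and> \<rho> (m \<cdot>\<^bsub>?M\<^esub> p) \<noteq> {}")
        case True
        then have eq: "s \<cdot>\<^bsub>?P\<^esub> t = Some (i, m \<cdot>\<^bsub>?M\<^esub> p, l)" using st' by simp
        have "s \<cdot>\<^bsub>?P\<^esub> t \<in> carrier ?P" unfolding C eq using st mp True by blast
        moreover have "\<phi> (s \<cdot>\<^bsub>?P\<^esub> t) = \<phi> s O \<phi> t"
          unfolding eq using True st mp by (simp add: \<phi> index_map_relcomp)
        ultimately show ?thesis ..
      next
        case False
        then have eq: "s \<cdot>\<^bsub>?P\<^esub> t = None" using st' by simp
        have "\<phi> s O \<phi> t = {}" using False st mp by (simp add: \<phi> index_map_relcomp)
        then show ?thesis unfolding eq by (simp add: C \<phi>)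
      qed
    qed
    then show "s \<cdot>\<^bsub>?P\<^esub> t \<in> carrier ?P" "\<phi> (s \<cdot>\<^bsub>?P\<^esub> t) = \<phi> s O \<phi> t" by auto
  qed
  have inj: "inj_on \<phi> (carrier ?P)"
  proof (rule inj_onI)
    fix s t assume st: "s \<in> carrier ?P" "t \<in> carrier ?P" and eq: "\<phi> s = \<phi> t"
    show "s = t"
    proof (cases "\<phi> s = {}")
      case True
      then have "\<phi> t = {}" using eq by simp
      then have "s = None" "t = None" using st True by (auto simp: C \<phi>)
      then show ?thesis by simp
    next
      case False
      have "\<phi> None = {}" by (simp add: \<phi>)
      then have "s \<noteq> None" "t \<noteq> None" using False eq by metis+
      then obtain i m j k p l where st': "s = Some (i, m, j)" "t = Some (k, p, l)"
        "m \<in> carrier ?M" "p \<in> carrier ?M" "\<rho> m \<noteq> {}"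
        using st unfolding C by blast
      then have "i = k \<and> j = l \<and> \<rho> m = \<rho> p"
        using eq by (intro index_map_inject) (simp_all add: \<phi>)
      then show ?thesis using st' by (simp add: M.eq_iff)
    qed
  qed
  show image: "\<phi> ` carrier ?P = prefix_family n (indexed_words n r)"
  proof
    show "\<phi> ` carrier ?P \<subseteq> prefix_family n (indexed_words n r)"
    proof (rule image_subsetI)
      fix s assume "s \<in> carrier ?P"
      then consider "s = None" | i m j where "s = Some (i, m, j)" "i \<in> {1..r}" "j \<in> {1..r}"
          "m \<in> carrier ?M" "\<rho> m \<noteq> {}"
        unfolding C by blast
      then show "\<phi> s \<in> prefix_family n (indexed_words n r)"
      proof cases
        case 1
        then show ?thesis by (simp add: \<phi> prefix_family_def)
      next
        case 2
        then have "\<rho> m \<in> prefix_family n (lists {1..n})" using M_image by blast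
        then obtain y x where yx: "y \<in> lists {1..n}" "x \<in> lists {1..n}" "\<rho> m = prefix_map n y x"
          using 2 by (cases rule: prefix_family_cases) auto
        have "\<phi> s = prefix_map n (i # y) (j # x)" using 2 yx by (simp add: \<phi> index_map_prefix_map)
        then show ?thesis using 2 yx by (simp only: prefix_map_in_family indexed_wordsI)
      qed
    qed
    show "prefix_family n (indexed_words n r) \<subseteq> \<phi> ` carrier ?P"
    proof
      fix R assume "R \<in> prefix_family n (indexed_words n r)"
      then show "R \<in> \<phi> ` carrier ?P"
      proof (cases rule: prefix_family_cases)
        case 1
        then have "R = \<phi> None" "None \<in> carrier ?P" by (simp_all add: C \<phi>)
        then show ?thesis by blast
      next
        case (2 u v)
        then obtain i j y x where uv: "u = i # y" "v = j # x" "i \<in> {1..r}" "j \<in> {1..r}"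
          "y \<in> lists {1..n}" "x \<in> lists {1..n}"
          unfolding indexed_words_def by blast
        then have "prefix_map n y x \<in> \<rho> ` carrier ?M"
          unfolding M_image by (intro prefix_map_in_family)
        then obtain m where m: "m \<in> carrier ?M" "\<rho> m = prefix_map n y x" by (metis imageE)
        then have "Some (i, m, j) \<in> carrier ?P" using uv prefix_map_nonempty[OF n] C by blast
        moreover have "R = \<phi> (Some (i, m, j))" using 2 uv m by (simp add: \<phi> index_map_prefix_map)
        ultimately show ?thesis by blast
      qed
    qed
  qed
  show "completable_rep ?P \<phi>"
  proof
    show "partial_bij_family (\<phi> ` carrier ?P)"
      unfolding image by (rule partial_bij_family_prefix_family)
    show "difference_family (\<phi> ` carrier ?P)"
      unfolding image by (rule difference_family_prefix_family) (rule indexed_words_append)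
  qed (fact closed hom inj)+
qed

section \<open>The stream space and the identity of the completion\<close>

text \<open>This is \<open>r\<close> copies of the aperiodic streams, tagged by the index; all
  elements of the completion act inside it.\<close>

definition boundary :: "nat \<Rightarrow> nat \<Rightarrow> nat stream set" where
  "boundary n r = {i ## w | i w. i \<in> {1..r} \<and> w \<in> aperiodic n}"

lemma shift_in_boundary:
  assumes "u \<in> indexed_words n r" "w \<in> aperiodic n"
  shows "u @- w \<in> boundary n r"
proof -
  obtain i y where "u = i # y" "i \<in> {1..r}" "y \<in> lists {1..n}"
    using assms(1) unfolding indexed_words_def by blast
  moreover have "y @- w \<in> aperiodic n"
    using assms(2) calculation shift_mem_aperiodic_iff by blast
  ultimately show ?thesis by (auto simp: boundary_def)
qed

lemma prefix_map_boundary: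
  "u \<in> indexed_words n r \<Longrightarrow> v \<in> indexed_words n r \<Longrightarrow>
    prefix_map n u v \<subseteq> boundary n r \<times> boundary n r"
  using shift_in_boundary by (fastforce simp: prefix_map_def)

text \<open>The terms on the right are the maps of the idempotents \<open>(i, 1, i)\<close>. As
  there are finitely many, the identity of the whole space belongs to the completion.\<close>

lemma Id_on_boundary: "Id_on (boundary n r) = (\<Union>i\<in>{1..r}. prefix_map n [i] [i])"
  by (force simp: boundary_def prefix_map_def)

lemma compatible_unions_boundary:
  assumes "R \<in> compatible_unions (prefix_family n (indexed_words n r))"
  shows "R \<subseteq> boundary n r \<times> boundary n r"
proof -
  obtain F where F: "R = \<Union>F" "F \<subseteq> prefix_family n (indexed_words n r)"
    using assms by (auto simp: compatible_unions_def)
  have "Q \<subseteq> boundary n r \<times> boundary n r" if "Q \<in> F" for Q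
    using subsetD[OF F(2) that]
  proof (cases rule: prefix_family_cases)
    case (2 u v)
    then show ?thesis by (simp add: prefix_map_boundary)
  qed simp
  then show ?thesis unfolding F(1) by (rule Union_least)
qed

lemma prefix_map_in_compatible_unions:
  "u \<in> W \<Longrightarrow> v \<in> W \<Longrightarrow> prefix_map n u v \<in> compatible_unions (prefix_family n W)"
  using compatible_unionsI[of "{prefix_map n u v}" "prefix_family n W"]
  by (simp add: prefix_map_in_family partial_bij_prefix_map)

lemma Id_on_boundary_in_compatible_unions:
  "Id_on (boundary n r) \<in> compatible_unions (prefix_family n (indexed_words n r))"
proof -
  have "partial_bij (Id_on (boundary n r))" by (rule partial_bij_subset_Id) auto
  then show ?thesis
    unfolding Id_on_boundary by (intro compatible_unionsI) (auto intro!: prefix_map_in_family indexed_wordsI)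
qed

section \<open>Folding the boundary into a cylinder\<close>

text \<open>The words \<open>1^i 2\<close> form an infinite prefix code over two letters, so there
  is one for each of the \<open>r\<close> indices however large \<open>r\<close> is compared with
  \<open>n\<close>.\<close>

definition code_word :: "nat \<Rightarrow> nat list" where
  "code_word i = replicate i 1 @ [2]"

text \<open>The position of the first letter 2 determines \<open>i\<close>, and then the rest of the
  stream.\<close>

lemma code_word_shift_inject: "code_word i @- w = code_word j @- w' \<Longrightarrow> i = j \<and> w = w'"
proof (induction i arbitrary: j)
  case 0
  then show ?case by (cases j) (auto simp: code_word_def)
next
  case (Suc i)
  then show ?case by (cases j) (auto simp: code_word_def)
qed

lemma code_word_in_lists: "n \<ge> 2 \<Longrightarrow> code_word i \<in> lists {1..n}"
  by (auto simp: code_word_def)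

text \<open>This map folds the whole boundary into the cylinder of \<open>u\<close>; it exists because the words
  \<open>code_word i\<close> form a prefix code, which requires two letters.\<close>

definition fold_map :: "nat \<Rightarrow> nat \<Rightarrow> nat list \<Rightarrow> (nat stream \<times> nat stream) set" where
  "fold_map n r u = (\<Union>i\<in>{1..r}. prefix_map n [i] (u @ code_word i))"

lemma fold_map_in_compatible_unions:
  assumes "n \<ge> 2" "u \<in> indexed_words n r"
  shows "fold_map n r u \<in> compatible_unions (prefix_family n (indexed_words n r))"
  unfolding fold_map_def
proof (rule compatible_unionsI)
  show "partial_bij (\<Union>i\<in>{1..r}. prefix_map n [i] (u @ code_word i))"
    by (rule partial_bijI) (auto simp: prefix_map_def dest!: code_word_shift_inject)
  show "(\<lambda>i. prefix_map n [i] (u @ code_word i)) ` {1..r} \<subseteq> prefix_family n (indexed_words n r)"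
    using assms by (intro image_subsetI prefix_map_in_family indexed_words_append code_word_in_lists
        indexed_wordsI) auto
qed simp

text \<open>Writing \<open>c\<close> for \<open>code_word i\<close>, the point \<open>i w\<close>
  goes to \<open>u c w\<close>, then to \<open>v c w\<close>, and back to \<open>i w\<close>. An
  inclusion persists when the middle map is enlarged to any element containing it.\<close>

lemma Id_on_boundary_subset_fold:
  assumes "n \<ge> 2"
  shows "Id_on (boundary n r) \<subseteq> fold_map n r u O prefix_map n u v O (fold_map n r v)\<inverse>"
proof
  fix p assume "p \<in> Id_on (boundary n r)"
  then obtain i w where p: "p = ([i] @- w, [i] @- w)" "i \<in> {1..r}" "w \<in> aperiodic n"
    by (auto simp: boundary_def)
  have "code_word i @- w \<in> aperiodic n"
    using p(3) code_word_in_lists[OF assms] shift_mem_aperiodic_iff by blast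
  then have "(u @- code_word i @- w, v @- code_word i @- w) \<in> prefix_map n u v" by (rule prefix_mapI)
  moreover have "([i] @- w, t @- code_word i @- w) \<in> fold_map n r t" for t
    unfolding fold_map_def using p prefix_mapI[OF p(3), of "[i]" "t @ code_word i"] by auto
  ultimately show "p \<in> fold_map n r u O prefix_map n u v O (fold_map n r v)\<inverse>"
    unfolding p(1) by blast
qed

lemma boundary_separated:
  assumes "q \<in> boundary n r" "q' \<noteq> q"
  obtains v where "v \<in> indexed_words n r" "(q, q) \<in> prefix_map n v v" "(q', q') \<notin> prefix_map n v v"
proof -
  obtain i w where q: "q = i ## w" "i \<in> {1..r}" "w \<in> aperiodic n"
    using assms(1) by (auto simp: boundary_def)
  obtain k where k: "q !! k \<noteq> q' !! k"
    using assms(2) smap_alt[of id q q'] by (auto simp: stream.map_id)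
  \<comment> \<open>The index and \<open>k\<close> letters make a prefix of length
    \<open>k + 1\<close>, which just covers the position \<open>k\<close> where \<open>q\<close> and
    \<open>q'\<close> differ.\<close>
  define v where "v = i # stake k w"
  have "stake k w @- sdrop k w \<in> aperiodic n" using q(3) by (simp add: stake_sdrop)
  then have kw: "stake k w \<in> lists {1..n}" "sdrop k w \<in> aperiodic n"
    unfolding shift_mem_aperiodic_iff by blast+
  have "v \<in> indexed_words n r" unfolding v_def using q(2) kw(1) by (rule indexed_wordsI)
  moreover have qv: "q = v @- sdrop k w" by (simp add: q v_def stake_sdrop)
  have "(q, q) \<in> prefix_map n v v" unfolding qv using kw(2) by (rule prefix_mapI)
  moreover have "(q', q') \<notin> prefix_map n v v"
  proof
    assume "(q', q') \<in> prefix_map n v v"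
    then obtain w' where "q' = v @- w'" by (auto simp: prefix_map_def)
    then have "q' !! k = v ! k" "q !! k = v ! k" unfolding qv by (simp_all add: v_def del: shift.simps)
    then show False using k by simp
  qed
  ultimately show thesis using that by blast
qed

section \<open>Compactability and the properties of the completion\<close>

theorem theorem4p5:
  fixes n r :: nat
  assumes "n \<ge> 2" and "r \<ge> 1"
  defines "P \<equiv> extended_polycyclic n r"
  defines "C \<equiv> distributive_completion P"
  shows "inverse_semigroup P \<and> pre_boolean P \<and> compactable P \<and>
    congruence_free C \<and> boolean_inverse_semigroup C \<and> inverse_meet_monoid C"
proof -
  define \<phi> where "\<phi> = brandt_map (\<lambda>m. \<Union>(word0_map n ` m))"
  let ?W = "indexed_words n r"
  let ?U = "compatible_unions (prefix_family n ?W)"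
  interpret P: completable_rep P \<phi>
    unfolding P_def \<phi>_def by (rule extended_polycyclic_rep[OF assms(1)])
  have P_image: "\<phi> ` carrier P = prefix_family n ?W"
    unfolding P_def \<phi>_def by (rule extended_polycyclic_image[OF assms(1)])
  obtain \<Phi> where C: "boolean_partial_bij_rep C \<Phi>" and C_image: "\<Phi> ` carrier C = ?U"
    using P.obtain_completion_rep unfolding P_image C_def by blast
  interpret C: boolean_partial_bij_rep C \<Phi> by (rule C)
  have C_obtain: "\<exists>x\<in>carrier C. \<Phi> x = R" if "R \<in> ?U" for R
    using that unfolding C_image[symmetric] by auto
  have C_boundary: "\<Phi> x \<subseteq> boundary n r \<times> boundary n r" if "x \<in> carrier C" for x
    using that C_image by (intro compatible_unions_boundary) auto
  obtain u where u: "u \<in> carrier C" "\<Phi> u = Id_on (boundary n r)"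
    using C_obtain[OF Id_on_boundary_in_compatible_unions] by blast
  have unit: "u \<cdot>\<^bsub>C\<^esub> x = x \<and> x \<cdot>\<^bsub>C\<^esub> u = x" if x: "x \<in> carrier C" for x
  proof -
    have "\<Phi> u O \<Phi> x = \<Phi> x" "\<Phi> x O \<Phi> u = \<Phi> x" using C_boundary[OF x] u(2) by auto
    then show ?thesis using x u(1) by (simp add: C.eq_iff C.mul_closed C.hom)
  qed
  have "inverse_meet_monoid C"
    using C.inverse_meet_semigroup C.semigroup u(1) unit
    unfolding inverse_meet_monoid_def is_monoid_def by blast
  moreover have "congruence_free C"
  proof (rule C.congruence_free)
    fix s p q q' assume s: "s \<in> carrier C" and pq: "(p, q) \<in> \<Phi> s" and q': "q' \<noteq> q"
    have "q \<in> boundary n r" using C_boundary[OF s] pq by blast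
    then obtain v where v: "v \<in> ?W" "(q, q) \<in> prefix_map n v v" "(q', q') \<notin> prefix_map n v v"
      using q' by (rule boundary_separated)
    obtain f where "f \<in> carrier C" "\<Phi> f = prefix_map n v v"
      using C_obtain[OF prefix_map_in_compatible_unions[OF v(1,1)]] by blast
    then show "\<exists>f\<in>idems C. (q, q) \<in> \<Phi> f \<and> (q', q') \<notin> \<Phi> f"
      using v prefix_map_subset_Id by (intro bexI[of _ f]) (simp_all add: C.idems_iff)
  next
    fix a assume a: "a \<in> carrier C" and nz: "\<Phi> a \<noteq> {}"
    then have "\<Phi> a \<in> ?U" using C_image by blast
    then obtain F where F: "\<Phi> a = \<Union>F" "F \<subseteq> prefix_family n ?W"
      by (auto simp: compatible_unions_def)
    then obtain R where R: "R \<in> F" "R \<noteq> {}" using nz by auto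
    then have "R \<in> prefix_family n ?W" using F(2) by blast
    then obtain y z where yz: "y \<in> ?W" "z \<in> ?W" "R = prefix_map n y z"
      using R(2) by (cases rule: prefix_family_cases) auto
    have sub: "prefix_map n y z \<subseteq> \<Phi> a" using R(1) yz(3) F(1) by auto
    \<comment> \<open>\<open>b\<close> folds the boundary into the cylinder of \<open>y\<close>, and
      the inverse \<open>d\<close> of \<open>c\<close> unfolds it from the cylinder of
      \<open>z\<close>; the chosen piece of \<open>a\<close> leads from the one cylinder to the
      other.\<close>
    obtain b c where b: "b \<in> carrier C" "\<Phi> b = fold_map n r y"
      and c: "c \<in> carrier C" "\<Phi> c = fold_map n r z"
      using C_obtain fold_map_in_compatible_unions[OF assms(1)] yz by meson
    define d where "d = sinv C c"
    have d: "d \<in> carrier C" "\<Phi> d = (fold_map n r z)\<inverse>"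
      unfolding d_def using C.sinv[OF c(1)] c(2) by simp_all
    have bad: "b \<cdot>\<^bsub>C\<^esub> a \<cdot>\<^bsub>C\<^esub> d \<in> carrier C" using a b d by (simp add: C.mul_closed)
    have "\<Phi> (b \<cdot>\<^bsub>C\<^esub> a \<cdot>\<^bsub>C\<^esub> d) = fold_map n r y O \<Phi> a O (fold_map n r z)\<inverse>"
      using a b d by (simp add: C.hom C.mul_closed O_assoc)
    moreover have "Id_on (boundary n r) \<subseteq> fold_map n r y O \<Phi> a O (fold_map n r z)\<inverse>"
      using Id_on_boundary_subset_fold[OF assms(1)] sub by (meson relcomp_mono order_refl order_trans)
    ultimately have Id: "Id_on (boundary n r) \<subseteq> \<Phi> (b \<cdot>\<^bsub>C\<^esub> a \<cdot>\<^bsub>C\<^esub> d)" by simp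
    \<comment> \<open>A partial bijection on the boundary that contains the whole diagonal has no
      further pairs, so the other pieces of \<open>a\<close> add nothing to the product.\<close>
    have "\<Phi> (b \<cdot>\<^bsub>C\<^esub> a \<cdot>\<^bsub>C\<^esub> d) \<subseteq> Id_on (boundary n r)"
    proof
      fix t assume t: "t \<in> \<Phi> (b \<cdot>\<^bsub>C\<^esub> a \<cdot>\<^bsub>C\<^esub> d)"
      obtain p q where pq: "t = (p, q)" by (cases t)
      have p: "p \<in> boundary n r" using C_boundary[OF bad] t pq by blast
      then have "(p, p) \<in> \<Phi> (b \<cdot>\<^bsub>C\<^esub> a \<cdot>\<^bsub>C\<^esub> d)" using Id by blast
      then have "p = q" using partial_bijD1[OF C.pbij[OF bad]] t pq by blast
      then show "t \<in> Id_on (boundary n r)" using p pq by auto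
    qed
    then have "b \<cdot>\<^bsub>C\<^esub> a \<cdot>\<^bsub>C\<^esub> d = u"
      using Id bad u by (simp add: C.eq_iff)
    then show "\<exists>x\<in>carrier C. \<exists>y\<in>carrier C. x \<cdot>\<^bsub>C\<^esub> a \<cdot>\<^bsub>C\<^esub> y = u" using b d by blast
  qed (use unit in blast)
  moreover have pre: "pre_boolean P"
    unfolding pre_boolean_def using P.inverse_meet_semigroup C.boolean_inverse_semigroup
    by (simp add: C_def)
  moreover have "compactable P"
  proof -
    have "\<exists>e\<in>carrier P. \<phi> e = prefix_map n [i] [i]" if "i \<in> {1..r}" for i
    proof -
      have "prefix_map n [i] [i] \<in> \<phi> ` carrier P"
        unfolding P_image using that by (intro prefix_map_in_family indexed_wordsI) auto
      then show ?thesis by (metis imageE)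
    qed
    \<comment> \<open>\<open>E i\<close> is the idempotent that acts as \<open>(i, 1, i)\<close>;
      the cylinders of these \<open>r\<close> elements cover the boundary, so every non-zero
      idempotent meets one of them.\<close>
    then obtain E where E: "\<And>i. i \<in> {1..r} \<Longrightarrow> E i \<in> carrier P"
      "\<And>i. i \<in> {1..r} \<Longrightarrow> \<phi> (E i) = prefix_map n [i] [i]" by metis
    have "essential_set P (E ` {1..r})"
      unfolding essential_set_def
    proof (intro conjI ballI)
      show "E ` {1..r} \<subseteq> idems P - {zero_of P}"
        using E prefix_map_subset_Id prefix_map_nonempty[OF assms(1)]
        by (intro image_subsetI) (simp add: P.idems_iff P.eq_zero_iff)
    next
      fix e assume "e \<in> idems P - {zero_of P}"
      then have e: "e \<in> carrier P" "\<phi> e \<subseteq> Id" "\<phi> e \<noteq> {}"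
        by (auto simp: P.idems_iff P.eq_zero_iff)
      then have "\<phi> e \<in> prefix_family n ?W" using P_image by blast
      then obtain y z where yz: "y \<in> ?W" "z \<in> ?W" "\<phi> e = prefix_map n y z"
        using e(3) by (cases rule: prefix_family_cases) auto
      have "\<phi> e \<subseteq> Id_on (boundary n r)"
        using prefix_map_boundary[OF yz(1,2)] e(2) yz(3) by auto
      then have "\<exists>i\<in>{1..r}. \<phi> e \<inter> prefix_map n [i] [i] \<noteq> {}"
        using e(3) unfolding Id_on_boundary by blast
      then obtain i where i: "i \<in> {1..r}" "\<phi> e \<inter> \<phi> (E i) \<noteq> {}"
        using E(2) by metis
      then have "e \<sqinter>\<^bsub>nat_order P\<^esub> E i \<noteq> zero_of P"
        using P.meet[OF e(1) E(1)] P.eq_zero_iff by metis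
      then show "\<exists>f\<in>E ` {1..r}. e \<sqinter>\<^bsub>nat_order P\<^esub> f \<noteq> zero_of P" using i by blast
    qed simp
    then show ?thesis using pre by (auto simp: compactable_def)
  qed
  ultimately show ?thesis
    using P.inverse_semigroup C.boolean_inverse_semigroup by blast
qed

end
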